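(* Let $n\geq 5$ and let $G$ be a connected graph on $n$ vertices with no pendant vertex. Then $F(G)\geq F(C_n)$ if $n\leq 16$, and $F(G)\geq F(C_{3,3}^n)$ if $n>16$. Moreover, $$F(G)\geq \min\left\{n^2+1,\ \frac{n^2+17n}{2}\right\}.$$
   Context: All graphs are finite, simple and undirected. A pendant vertex is a vertex of degree one. $C_m$ is the cycle on $m$ vertices. For $n\geq 5$, $C_{3,3}^n$ is the graph on $n$ vertices obtained as follows: if $n\geq 6$, take a path on $n-4$ vertices and identify one end vertex of the path with a vertex of a triangle $C_3$ and the other end vertex with a vertex of a second (disjoint) triangle $C_3$; if $n=5$, it is two triangles sharing exactly one vertex. A connected subgraph of a graph $G=(V,E)$ is a graph $(V',E')$ with $\emptyset\neq V'\subseteq V$, $E'\subseteq E$, every edge of $E'$ having both endpoints in $V'$, and $(V',E')$ connected; distinct pairs $(V',E')$ are counted separately. The core index $F(G)$ is the number of connected subgraphs of $G$. *)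

theory Defs
  imports Complex_Main
begin

text \<open>A graph is a pair (V, E) of vertices and edges, an edge being a two-element set of vertices.\<close>

type_synonym 'a ugraph = "'a set \<times> 'a set set"

definition simple_graph :: "'a ugraph \<Rightarrow> bool" where
  "simple_graph G \<longleftrightarrow> finite (fst G) \<and> (\<forall>e\<in>snd G. e \<subseteq> fst G \<and> card e = 2)"

definition degree :: "'a ugraph \<Rightarrow> 'a \<Rightarrow> nat" where
  "degree G v = card {e \<in> snd G. v \<in> e}"

definition pendant_vertex :: "'a ugraph \<Rightarrow> 'a \<Rightarrow> bool" where
  "pendant_vertex G v \<longleftrightarrow> v \<in> fst G \<and> degree G v = 1"

definition adj :: "'a ugraph \<Rightarrow> ('a \<times> 'a) set" where
  "adj G = {(x, y). {x, y} \<in> snd G}"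

definition connected_graph :: "'a ugraph \<Rightarrow> bool" where
  "connected_graph G \<longleftrightarrow> fst G \<noteq> {} \<and> (\<forall>u\<in>fst G. \<forall>v\<in>fst G. (u, v) \<in> (adj G)\<^sup>*)"

definition subgraph :: "'a ugraph \<Rightarrow> 'a ugraph \<Rightarrow> bool" where
  "subgraph H G \<longleftrightarrow> fst H \<subseteq> fst G \<and> snd H \<subseteq> snd G \<and> (\<forall>e\<in>snd H. e \<subseteq> fst H)"

definition core_index :: "'a ugraph \<Rightarrow> nat" where
  "core_index G = card {H. subgraph H G \<and> connected_graph H}"

text \<open>This is the cycle on n vertices only for n at least 3.\<close>

definition cycle_graph :: "nat \<Rightarrow> nat ugraph" where
  "cycle_graph n = ({..<n}, {{i, (i + 1) mod n} |i. i < n})"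

text \<open>For n at least 5. The path has the n - 4 vertices 0, ..., n - 5; its ends 0 and n - 5 lie on
  the triangles \<open>{0, n - 4, n - 3}\<close> and \<open>{n - 5, n - 2, n - 1}\<close>. For n = 5 the two ends coincide,
  and the triangles share exactly the vertex 0.\<close>

definition two_triangle_graph :: "nat \<Rightarrow> nat ugraph" where
  "two_triangle_graph n =
    ({..<n},
     {{i, i + 1} |i. i + 1 < n - 4}
     \<union> {{0, n - 4}, {0, n - 3}, {n - 4, n - 3}}
     \<union> {{n - 5, n - 2}, {n - 5, n - 1}, {n - 2, n - 1}})"

end

theory Submission
  imports Defs
begin

text \<open>
  Write n and m for the numbers of vertices and edges; minimum degree two forces m at least n.
  Contracting an edge va that lies in no triangle lowers the core index by exactly the number of
  connected subgraphs that avoid the edge va and contain v or a.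
  If m = n the graph is a cycle, this number is 2n - 1, and contraction down to a triangle yields
  n^2 + 1. If m > n, one shows (n^2 + 17n)/2 by induction, now also allowing pendant vertices:
  for a bridge va both sides are non-trees by the handshake lemma, and a connected non-tree on k
  vertices has at least k + 4 connected subgraphs through a given vertex (k non-spanning and
  4 spanning ones), so the loss is at least n + 8, which is the increment of the bound; a non-bridge
  does at least as well, a pendant vertex can be deleted, and if every edge lies in a triangle then
  m is so large that an edge can be deleted. The house (a pentagon with a chord) violates the bound
  by one at n = 5, so the step from 5 to 6 vertices has to gain one more.
  The two-triangle graph attains the bound because the connected subgraphs of a graph with a bridge
  are those of the two sides and the pairs of connected subgraphs through its ends.
\<close>

section \<open>Connected graphs\<close>

abbreviation verts :: "'a ugraph \<Rightarrow> 'a set" where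
  "verts G \<equiv> fst G"

abbreviation edges :: "'a ugraph \<Rightarrow> 'a set set" where
  "edges G \<equiv> snd G"

lemma in_adj_iff: "(x, y) \<in> adj G \<longleftrightarrow> {x, y} \<in> edges G"
  by (simp add: adj_def)

lemma adj_rtrancl_mono: "edges H \<subseteq> edges G \<Longrightarrow> (adj H)\<^sup>* \<subseteq> (adj G)\<^sup>*"
  by (intro rtrancl_mono) (auto simp: in_adj_iff)

lemma adj_rtrancl_sym:
  assumes "(x, y) \<in> (adj G)\<^sup>*"
  shows "(y, x) \<in> (adj G)\<^sup>*"
proof -
  have "sym (adj G)" by (auto simp: sym_def in_adj_iff insert_commute)
  then show ?thesis using assms sym_rtrancl[of "adj G"] by (auto dest: symD)
qed

lemma rtrancl_leaves_set:
  assumes "(x, y) \<in> r\<^sup>*" "x \<in> S" "y \<notin> S"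
  obtains u w where "(u, w) \<in> r" "u \<in> S" "w \<notin> S"
  using assms by (induction rule: rtrancl_induct) auto

lemma connected_graph_crossing_edge:
  assumes "connected_graph G" "x \<in> verts G" "y \<in> verts G" "x \<in> S" "y \<notin> S"
  obtains u w where "{u, w} \<in> edges G" "u \<in> S" "w \<notin> S"
proof -
  have "(x, y) \<in> (adj G)\<^sup>*" using assms by (simp add: connected_graph_def)
  then show ?thesis
    using assms(4,5) that by (rule rtrancl_leaves_set) (simp add: in_adj_iff)
qed

lemma connected_graph_from_root:
  assumes "r \<in> verts G" "\<And>x. x \<in> verts G \<Longrightarrow> (r, x) \<in> (adj G)\<^sup>*"
  shows "connected_graph G"
  unfolding connected_graph_def
proof (intro conjI ballI)
  show "verts G \<noteq> {}" using assms(1) by blast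
  fix x y assume "x \<in> verts G" "y \<in> verts G"
  then have "(x, r) \<in> (adj G)\<^sup>*" "(r, y) \<in> (adj G)\<^sup>*"
    using adj_rtrancl_sym[OF assms(2)[of x]] assms(2)[of y] by simp_all
  then show "(x, y) \<in> (adj G)\<^sup>*" by (rule rtrancl_trans)
qed

lemma connected_graph_nonempty: "connected_graph G \<Longrightarrow> verts G \<noteq> {}"
  by (simp add: connected_graph_def)

lemma connected_graph_singleton: "connected_graph ({v}, D)"
  by (simp add: connected_graph_def)

lemma connected_graph_map:
  assumes con: "connected_graph G" and onto: "f ` verts G = verts H"
    and adj: "\<And>x y. {x, y} \<in> edges G \<Longrightarrow> (f x, f y) \<in> (adj H)\<^sup>*"
  shows "connected_graph H"
proof -
  have image_path: "(f x, f y) \<in> (adj H)\<^sup>*" if "(x, y) \<in> (adj G)\<^sup>*" for x y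
    using that
  proof (induction rule: rtrancl_induct)
    case (step y z)
    then show ?case using adj[of y z] by (simp add: in_adj_iff)
  qed simp
  show ?thesis
    unfolding connected_graph_def onto[symmetric]
    using con by (auto simp: connected_graph_def intro: image_path)
qed

definition bridge_join :: "'a \<Rightarrow> 'a \<Rightarrow> 'a ugraph \<Rightarrow> 'a ugraph \<Rightarrow> 'a ugraph" where
  "bridge_join v a A B = (verts A \<union> verts B, insert {v, a} (edges A \<union> edges B))"

lemma verts_bridge_join [simp]: "verts (bridge_join v a A B) = verts A \<union> verts B"
  by (simp add: bridge_join_def)

lemma edges_bridge_join [simp]:
  "edges (bridge_join v a A B) = insert {v, a} (edges A \<union> edges B)"
  by (simp add: bridge_join_def)

lemma bridge_join_commute: "bridge_join v a A B = bridge_join a v B A"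
  by (auto simp: bridge_join_def)

lemma connected_bridge_join:
  assumes A: "connected_graph A" "v \<in> verts A" and B: "connected_graph B" "a \<in> verts B"
  shows "connected_graph (bridge_join v a A B)" (is "connected_graph ?J")
proof (rule connected_graph_from_root)
  show "v \<in> verts ?J" using A(2) by simp
  fix x assume "x \<in> verts ?J"
  then consider (left) "x \<in> verts A" | (right) "x \<in> verts B" by auto
  then show "(v, x) \<in> (adj ?J)\<^sup>*"
  proof cases
    case left
    then have "(v, x) \<in> (adj A)\<^sup>*" using A by (simp add: connected_graph_def)
    then show ?thesis using adj_rtrancl_mono[of A ?J] by auto
  next
    case right
    then have "(a, x) \<in> (adj B)\<^sup>*" using B by (simp add: connected_graph_def)
    then have "(a, x) \<in> (adj ?J)\<^sup>*" using adj_rtrancl_mono[of B ?J] by auto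
    moreover have "(v, a) \<in> adj ?J" by (simp add: in_adj_iff)
    ultimately show ?thesis by (rule converse_rtrancl_into_rtrancl[rotated])
  qed
qed

lemma connected_graph_mono:
  assumes "connected_graph G" "verts G = verts H" "edges G \<subseteq> edges H"
  shows "connected_graph H"
proof (rule connected_graph_map[where f = id, OF assms(1)])
  fix x y assume "{x, y} \<in> edges G"
  then have "(x, y) \<in> adj H" using assms(3) by (auto simp: in_adj_iff)
  then show "(id x, id y) \<in> (adj H)\<^sup>*" by auto
qed (simp add: assms(2))

section \<open>Simple graphs and degrees\<close>

lemma simple_graph_finite:
  assumes "simple_graph G"
  shows "finite (verts G)" "finite (edges G)"
proof -
  show fin: "finite (verts G)" using assms by (simp add: simple_graph_def)
  have "edges G \<subseteq> Pow (verts G)" using assms by (auto simp: simple_graph_def)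
  then show "finite (edges G)" using fin by (simp add: finite_subset)
qed

lemma simple_graph_edge_ends:
  assumes "simple_graph G" "{x, y} \<in> edges G"
  shows "x \<noteq> y" "x \<in> verts G" "y \<in> verts G"
  using assms by (auto simp: simple_graph_def)

lemma simple_graph_edgeE:
  assumes "simple_graph G" "e \<in> edges G"
  obtains x y where "e = {x, y}" "x \<noteq> y" "x \<in> verts G" "y \<in> verts G"
  using assms by (fastforce simp: simple_graph_def card_2_iff)

lemma simple_graph_edge_atE:
  assumes "simple_graph G" "e \<in> edges G" "x \<in> e"
  obtains y where "e = {x, y}" "x \<noteq> y" "y \<in> verts G"
proof -
  obtain p q where "e = {p, q}" "p \<noteq> q" "p \<in> verts G" "q \<in> verts G"
    using simple_graph_edgeE[OF assms(1,2)] .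
  then show ?thesis using assms(3) that[of p] that[of q] by (auto simp: insert_commute)
qed

lemma simple_graph_subgraph: "simple_graph G \<Longrightarrow> subgraph H G \<Longrightarrow> simple_graph H"
  by (auto simp: simple_graph_def subgraph_def intro: finite_subset)

lemma subgraph_trans: "subgraph H K \<Longrightarrow> subgraph K G \<Longrightarrow> subgraph H G"
  by (auto simp: subgraph_def)

lemma subgraph_order_eq:
  assumes "simple_graph G" "subgraph H G" "card (verts H) = card (verts G)"
  shows "verts H = verts G"
  using assms(2,3) simple_graph_finite(1)[OF assms(1)]
  by (intro card_subset_eq) (simp_all add: subgraph_def)

lemma handshake:
  assumes "simple_graph G"
  shows "(\<Sum>v\<in>verts G. degree G v) = 2 * card (edges G)"
proof -
  have "card {v \<in> verts G. v \<in> e} = 2" if "e \<in> edges G" for e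
  proof -
    have "{v \<in> verts G. v \<in> e} = e" using that assms by (auto simp: simple_graph_def)
    then show ?thesis using that assms by (simp add: simple_graph_def)
  qed
  then show ?thesis
    unfolding degree_def using simple_graph_finite[OF assms] by (intro sum_multicount) auto
qed

text \<open>The exceptional vertex is the end of a bridge, seen from its own side.\<close>

lemma order_le_size:
  assumes G: "simple_graph G" "v \<in> verts G"
    and deg: "1 \<le> degree G v" "\<And>x. x \<in> verts G \<Longrightarrow> x \<noteq> v \<Longrightarrow> 2 \<le> degree G x"
  shows "card (verts G) \<le> card (edges G)"
proof -
  have fin: "finite (verts G)" using simple_graph_finite(1)[OF G(1)] .
  have "2 * card (verts G - {v}) = (\<Sum>x\<in>verts G - {v}. 2)" by simp
  also have "\<dots> \<le> (\<Sum>x\<in>verts G - {v}. degree G x)" using deg by (intro sum_mono) auto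
  also have "\<dots> + degree G v = 2 * card (edges G)"
    using handshake[OF G(1)] sum.remove[OF fin G(2), of "degree G"] by simp
  finally have "2 * card (verts G - {v}) + degree G v \<le> 2 * card (edges G)" by simp
  then show ?thesis using deg(1) card_Suc_Diff1[OF fin G(2)] by linarith
qed

lemma degree_mono:
  assumes "simple_graph G" "subgraph H G"
  shows "degree H x \<le> degree G x"
  unfolding degree_def
proof (rule card_mono)
  show "finite {e \<in> edges G. x \<in> e}" using simple_graph_finite(2)[OF assms(1)] by simp
  show "{e \<in> edges H. x \<in> e} \<subseteq> {e \<in> edges G. x \<in> e}" using assms(2) by (auto simp: subgraph_def)
qed

lemma degree_pos:
  assumes G: "connected_graph G" "simple_graph G" and v: "v \<in> verts G" and n: "2 \<le> card (verts G)"
  shows "1 \<le> degree G v"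
proof -
  have "verts G \<noteq> {v}" using n by auto
  then obtain w where w: "w \<in> verts G" "w \<notin> {v}" using v by blast
  obtain x y where "{x, y} \<in> edges G" "x \<in> {v}"
    by (rule connected_graph_crossing_edge[OF G(1) v w(1) _ w(2)]) auto
  then have "{e \<in> edges G. v \<in> e} \<noteq> {}" by blast
  then show ?thesis
    using simple_graph_finite(2)[OF G(2)] by (simp add: degree_def Suc_le_eq card_gt_0_iff)
qed

lemma two_neighbours:
  assumes G: "simple_graph G" and deg: "2 \<le> degree G v"
  obtains x y where "{v, x} \<in> edges G" "{v, y} \<in> edges G" "x \<noteq> y"
proof -
  obtain e f where ef: "e \<in> edges G" "v \<in> e" "f \<in> edges G" "v \<in> f" "e \<noteq> f"
    using deg by (auto simp: degree_def numeral_2_eq_2 card_le_Suc_iff)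
  obtain x where "e = {v, x}" by (rule simple_graph_edge_atE[OF G ef(1,2)])
  moreover obtain y where "f = {v, y}" by (rule simple_graph_edge_atE[OF G ef(3,4)])
  ultimately show ?thesis using that[of x y] ef by auto
qed

lemma degree_one_neighbour:
  assumes G: "simple_graph G" and deg: "degree G v = 1"
  obtains x where "{e \<in> edges G. v \<in> e} = {{v, x}}" "x \<noteq> v" "x \<in> verts G"
proof -
  obtain e where e: "{e \<in> edges G. v \<in> e} = {e}"
    using deg by (auto simp: degree_def card_1_singleton_iff)
  then obtain x where "e = {v, x}" "v \<noteq> x" "x \<in> verts G"
    using simple_graph_edge_atE[OF G, of e v] by blast
  then show ?thesis using that e by blast
qed

section \<open>Induced subgraphs, deletion and components\<close>

definition induced :: "'a ugraph \<Rightarrow> 'a set \<Rightarrow> 'a ugraph" where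
  "induced G W = (W, {e \<in> edges G. e \<subseteq> W})"

definition delete_vertex :: "'a ugraph \<Rightarrow> 'a \<Rightarrow> 'a ugraph" where
  "delete_vertex G v = induced G (verts G - {v})"

definition delete_edge :: "'a ugraph \<Rightarrow> 'a set \<Rightarrow> 'a ugraph" where
  "delete_edge G e = (verts G, edges G - {e})"

definition component :: "'a ugraph \<Rightarrow> 'a \<Rightarrow> 'a set" where
  "component G v = {u. (v, u) \<in> (adj G)\<^sup>*}"

lemma verts_induced [simp]: "verts (induced G W) = W"
  by (simp add: induced_def)

lemma edges_induced [simp]: "edges (induced G W) = {e \<in> edges G. e \<subseteq> W}"
  by (simp add: induced_def)

lemma verts_delete_vertex [simp]: "verts (delete_vertex G v) = verts G - {v}"
  by (simp add: delete_vertex_def)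

lemma edges_delete_vertex:
  "simple_graph G \<Longrightarrow> edges (delete_vertex G v) = {e \<in> edges G. v \<notin> e}"
  by (auto simp: delete_vertex_def simple_graph_def)

lemma verts_delete_edge [simp]: "verts (delete_edge G e) = verts G"
  by (simp add: delete_edge_def)

lemma edges_delete_edge [simp]: "edges (delete_edge G e) = edges G - {e}"
  by (simp add: delete_edge_def)

lemma subgraph_induced: "W \<subseteq> verts G \<Longrightarrow> subgraph (induced G W) G"
  by (auto simp: subgraph_def)

lemma subgraph_delete_vertex: "subgraph (delete_vertex G v) G"
  by (simp add: delete_vertex_def subgraph_induced)

lemma subgraph_delete_edge: "simple_graph G \<Longrightarrow> subgraph (delete_edge G e) G"
  by (auto simp: subgraph_def simple_graph_def)

lemmas simple_graph_induced = simple_graph_subgraph[OF _ subgraph_induced]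
lemmas simple_graph_delete_vertex = simple_graph_subgraph[OF _ subgraph_delete_vertex]

lemma simple_graph_delete_edge: "simple_graph G \<Longrightarrow> simple_graph (delete_edge G e)"
  using simple_graph_subgraph subgraph_delete_edge by blast

lemma card_edges_delete_edge:
  "simple_graph G \<Longrightarrow> e \<in> edges G \<Longrightarrow> Suc (card (edges (delete_edge G e))) = card (edges G)"
  by (metis card_Suc_Diff1 edges_delete_edge simple_graph_finite(2))

lemma card_verts_delete_vertex:
  "simple_graph G \<Longrightarrow> v \<in> verts G \<Longrightarrow> Suc (card (verts (delete_vertex G v))) = card (verts G)"
  by (metis card_Suc_Diff1 simple_graph_finite(1) verts_delete_vertex)

lemma delete_vertex_delete_edge:
  "v \<in> e \<Longrightarrow> delete_vertex (delete_edge G e) v = delete_vertex G v"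
  by (auto simp: delete_vertex_def induced_def)

lemma degree_delete_edge:
  assumes "simple_graph G" "e \<in> edges G"
  shows "degree G x = degree (delete_edge G e) x + of_bool (x \<in> e)"
proof (cases "x \<in> e")
  case True
  have "{d \<in> edges G. x \<in> d} = insert e {d \<in> edges (delete_edge G e). x \<in> d}"
    using assms(2) True by auto
  then show ?thesis using True simple_graph_finite(2)[OF assms(1)] by (simp add: degree_def)
next
  case False
  then have "{d \<in> edges G. x \<in> d} = {d \<in> edges (delete_edge G e). x \<in> d}" by auto
  then show ?thesis using False by (simp add: degree_def)
qed

lemma degree_delete_neighbour:
  assumes G: "simple_graph G" and vx: "{v, x} \<in> edges G"
  shows "degree G x = Suc (degree (delete_vertex G v) x)"
proof -
  have "d = {v, x}" if "d \<in> edges G" "x \<in> d" "v \<in> d" for d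
    using simple_graph_edge_atE[OF G that(1,2)] that(3) simple_graph_edge_ends(1)[OF G vx] by blast
  then have "{d \<in> edges G. x \<in> d} = insert {v, x} {d \<in> edges (delete_vertex G v). x \<in> d}"
    unfolding edges_delete_vertex[OF G] using vx by blast
  moreover have "{v, x} \<notin> {d \<in> edges (delete_vertex G v). x \<in> d}"
    by (simp add: edges_delete_vertex[OF G])
  moreover have "finite {d \<in> edges (delete_vertex G v). x \<in> d}"
    using simple_graph_finite(2)[OF simple_graph_delete_vertex[OF G]] by simp
  ultimately show ?thesis by (simp add: degree_def)
qed

lemma card_edges_delete_vertex:
  assumes "simple_graph G"
  shows "card (edges G) = card (edges (delete_vertex G v)) + degree G v"
proof -
  have "card (edges G) = card {e \<in> edges G. v \<notin> e} + card {e \<in> edges G. v \<in> e}"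
    using simple_graph_finite(2)[OF assms]
    by (subst card_Un_disjoint[symmetric]) (auto intro: arg_cong[where f = card])
  then show ?thesis by (simp add: edges_delete_vertex[OF assms] degree_def)
qed

lemma component_self: "v \<in> component G v"
  by (simp add: component_def)

lemma component_closed: "u \<in> component G v \<Longrightarrow> {u, w} \<in> edges G \<Longrightarrow> w \<in> component G v"
  by (auto simp: component_def in_adj_iff intro: rtrancl_into_rtrancl)

lemma component_subset:
  assumes "simple_graph G" "v \<in> verts G"
  shows "component G v \<subseteq> verts G"
proof
  fix u assume "u \<in> component G v"
  then have "(v, u) \<in> (adj G)\<^sup>*" by (simp add: component_def)
  then show "u \<in> verts G"
    using assms(2) simple_graph_edge_ends[OF assms(1)]
    by (induction rule: rtrancl_induct) (auto simp: in_adj_iff)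
qed

lemma component_edge:
  assumes "simple_graph G" "e \<in> edges G" "x \<in> e" "x \<in> component G v"
  shows "e \<subseteq> component G v"
proof -
  obtain y where "e = {x, y}" using simple_graph_edge_atE[OF assms(1-3)] .
  then show ?thesis using component_closed[OF assms(4)] assms(2,4) by simp
qed

lemma connected_induced_component: "connected_graph (induced G (component G v))"
proof (rule connected_graph_from_root)
  show "v \<in> verts (induced G (component G v))" by (simp add: component_self)
next
  fix x assume "x \<in> verts (induced G (component G v))"
  then have "(v, x) \<in> (adj G)\<^sup>*" by (simp add: component_def)
  then show "(v, x) \<in> (adj (induced G (component G v)))\<^sup>*"
  proof (induction rule: rtrancl_induct)
    case (step y z)
    then have "y \<in> component G v" "z \<in> component G v"
      by (auto simp: component_def intro: rtrancl_into_rtrancl)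
    then have "(y, z) \<in> adj (induced G (component G v))" using step by (simp add: in_adj_iff)
    then show ?case using step.IH by simp
  qed simp
qed

lemma connected_delete_edge:
  assumes con: "connected_graph G" and detour: "(x, y) \<in> (adj (delete_edge G {x, y}))\<^sup>*"
  shows "connected_graph (delete_edge G {x, y})"
proof (rule connected_graph_map[where f = id, OF con])
  fix p q assume "{p, q} \<in> edges G"
  then consider "(p, q) \<in> adj (delete_edge G {x, y})" | "{p, q} = {x, y}"
    by (auto simp: in_adj_iff)
  then show "(id p, id q) \<in> (adj (delete_edge G {x, y}))\<^sup>*"
    by cases (use detour adj_rtrancl_sym[OF detour] in \<open>auto simp: doubleton_eq_iff\<close>)
qed simp

lemma connected_delete_degree_one:
  assumes G: "connected_graph G" "simple_graph G" and deg: "degree G v = 1"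
  shows "connected_graph (delete_vertex G v)"
proof -
  obtain x where x: "{e \<in> edges G. v \<in> e} = {{v, x}}" "x \<noteq> v" "x \<in> verts G"
    using degree_one_neighbour[OF G(2) deg] .
  show ?thesis
  proof (rule connected_graph_map[where f = "id(v := x)", OF G(1)])
    show "(id(v := x)) ` verts G = verts (delete_vertex G v)" using x(2,3) by auto
    fix p q assume pq: "{p, q} \<in> edges G"
    show "((id(v := x)) p, (id(v := x)) q) \<in> (adj (delete_vertex G v))\<^sup>*"
    proof (cases "v \<in> {p, q}")
      case True
      then have "{p, q} \<in> {e \<in> edges G. v \<in> e}" using pq by simp
      then have "{p, q} = {v, x}" unfolding x(1) by simp
      then show ?thesis using x(2) by (auto simp: doubleton_eq_iff)
    next
      case False
      then have "(p, q) \<in> adj (delete_vertex G v)"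
        using pq by (simp add: in_adj_iff edges_delete_vertex[OF G(2)])
      then show ?thesis using False by auto
    qed
  qed
qed

section \<open>Families of connected subgraphs\<close>

definition conn_subgraphs :: "'a ugraph \<Rightarrow> 'a ugraph set" where
  "conn_subgraphs G = {H. subgraph H G \<and> connected_graph H}"

definition meeting :: "'a ugraph \<Rightarrow> 'a set \<Rightarrow> 'a ugraph set" where
  "meeting G S = {H \<in> conn_subgraphs G. verts H \<inter> S \<noteq> {}}"

abbreviation rooted :: "'a ugraph \<Rightarrow> 'a \<Rightarrow> 'a ugraph set" where
  "rooted G v \<equiv> meeting G {v}"

lemma core_index_eq: "core_index G = card (conn_subgraphs G)"
  by (simp add: core_index_def conn_subgraphs_def)

lemma conn_subgraphsD:
  assumes "H \<in> conn_subgraphs G"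
  shows "subgraph H G" "connected_graph H"
  using assms by (simp_all add: conn_subgraphs_def)

lemma mem_rooted_iff: "H \<in> rooted G v \<longleftrightarrow> subgraph H G \<and> connected_graph H \<and> v \<in> verts H"
  by (auto simp: meeting_def conn_subgraphs_def)

lemma rooted_eq: "rooted G v = {H \<in> conn_subgraphs G. v \<in> verts H}"
  by (auto simp: meeting_def)

lemma singleton_rooted: "v \<in> verts G \<Longrightarrow> ({v}, {}) \<in> rooted G v"
  by (simp add: mem_rooted_iff subgraph_def connected_graph_singleton)

lemma finite_conn_subgraphs:
  assumes "simple_graph G"
  shows "finite (conn_subgraphs G)"
proof (rule finite_subset)
  show "conn_subgraphs G \<subseteq> Pow (verts G) \<times> Pow (edges G)"
    by (auto simp: conn_subgraphs_def subgraph_def)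
  show "finite (Pow (verts G) \<times> Pow (edges G))"
    using simple_graph_finite[OF assms] by simp
qed

lemma finite_meeting: "simple_graph G \<Longrightarrow> finite (meeting G S)"
  by (simp add: meeting_def finite_conn_subgraphs)

lemma conn_subgraphs_mono: "subgraph H G \<Longrightarrow> conn_subgraphs H \<subseteq> conn_subgraphs G"
  unfolding conn_subgraphs_def using subgraph_trans by blast

lemma meeting_mono: "subgraph H G \<Longrightarrow> meeting H S \<subseteq> meeting G S"
  unfolding meeting_def using conn_subgraphs_mono by blast

lemma core_index_mono: "simple_graph G \<Longrightarrow> subgraph H G \<Longrightarrow> core_index H \<le> core_index G"
  unfolding core_index_eq by (intro card_mono finite_conn_subgraphs conn_subgraphs_mono)

lemma card_meeting_mono:
  "simple_graph G \<Longrightarrow> subgraph H G \<Longrightarrow> card (meeting H S) \<le> card (meeting G S)"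
  by (intro card_mono finite_meeting meeting_mono)

lemma conn_subgraphs_induced:
  "W \<subseteq> verts G \<Longrightarrow> conn_subgraphs (induced G W) = {H \<in> conn_subgraphs G. verts H \<subseteq> W}"
  by (fastforce simp: conn_subgraphs_def subgraph_def)

lemma core_index_delete:
  assumes "simple_graph G"
  shows "core_index G = core_index (induced G (verts G - S)) + card (meeting G S)"
proof -
  have "conn_subgraphs (induced G (verts G - S)) = {H \<in> conn_subgraphs G. verts H \<inter> S = {}}"
    by (subst conn_subgraphs_induced) (auto simp: conn_subgraphs_def subgraph_def)
  then show ?thesis
    unfolding core_index_eq meeting_def using finite_conn_subgraphs[OF assms]
    by (subst card_Un_disjoint[symmetric]) (auto intro: arg_cong[where f = card])
qed

lemma core_index_delete_vertex:
  "simple_graph G \<Longrightarrow> core_index G = core_index (delete_vertex G v) + card (rooted G v)"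
  unfolding delete_vertex_def by (rule core_index_delete)

lemma card_meeting_insert:
  assumes "simple_graph G"
  shows "card (meeting G (insert v S)) = card (rooted G v) + card (meeting (delete_vertex G v) S)"
proof -
  have "conn_subgraphs (delete_vertex G v) = {H \<in> conn_subgraphs G. v \<notin> verts H}"
    unfolding delete_vertex_def
    by (subst conn_subgraphs_induced) (auto simp: conn_subgraphs_def subgraph_def)
  then have "meeting G (insert v S) = rooted G v \<union> meeting (delete_vertex G v) S"
    and "rooted G v \<inter> meeting (delete_vertex G v) S = {}"
    by (auto simp: meeting_def)
  then show ?thesis
    using finite_meeting[OF assms, of "insert v S"] by (simp add: card_Un_disjoint)
qed

section \<open>Spanning subgraphs\<close>

definition spanning :: "'a ugraph \<Rightarrow> 'a set set set" where
  "spanning G = {D. D \<subseteq> edges G \<and> connected_graph (verts G, D)}"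

definition nonspanning :: "'a ugraph \<Rightarrow> 'a \<Rightarrow> 'a ugraph set" where
  "nonspanning G v = {H \<in> rooted G v. verts H \<noteq> verts G}"

lemma finite_spanning: "simple_graph G \<Longrightarrow> finite (spanning G)"
  using simple_graph_finite(2)[of G] by (simp add: spanning_def)

lemma finite_nonspanning: "simple_graph G \<Longrightarrow> finite (nonspanning G v)"
  by (simp add: nonspanning_def finite_meeting)

lemma simple_graph_edge_subset: "simple_graph G \<Longrightarrow> D \<subseteq> edges G \<Longrightarrow> simple_graph (verts G, D)"
  by (auto simp: simple_graph_def)

lemma card_rooted_eq:
  assumes G: "simple_graph G" and v: "v \<in> verts G"
  shows "card (rooted G v) = card (nonspanning G v) + card (spanning G)"
proof -
  have "Pair (verts G) ` spanning G = {H \<in> rooted G v. verts H = verts G}"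
    using G v by (fastforce simp: spanning_def mem_rooted_iff subgraph_def simple_graph_def)
  then have "rooted G v = nonspanning G v \<union> Pair (verts G) ` spanning G"
    and "nonspanning G v \<inter> Pair (verts G) ` spanning G = {}"
    by (auto simp: nonspanning_def)
  moreover have "card (Pair (verts G) ` spanning G) = card (spanning G)"
    by (simp add: card_image inj_on_def)
  ultimately show ?thesis
    using finite_nonspanning[OF G] finite_spanning[OF G] by (simp add: card_Un_disjoint)
qed

lemma subtree_exists:
  assumes G: "connected_graph G" "simple_graph G" and v: "v \<in> verts G"
    and k: "1 \<le> k" "k \<le> card (verts G)"
  shows "\<exists>H \<in> rooted G v. card (verts H) = k \<and> Suc (card (edges H)) = k"
  using k
proof (induction rule: dec_induct)
  case base
  then show ?case using singleton_rooted[OF v] by (intro bexI[of _ "({v}, {})"]) auto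
next
  case (step k)
  then obtain H where "H \<in> rooted G v" and k: "card (verts H) = k" "Suc (card (edges H)) = k"
    by auto
  then have H: "subgraph H G" "connected_graph H" "v \<in> verts H" by (simp_all add: mem_rooted_iff)
  have sim: "simple_graph H" by (rule simple_graph_subgraph[OF G(2) H(1)])
  have "verts H \<noteq> verts G" using k step by auto
  then obtain y where y: "y \<in> verts G" "y \<notin> verts H" using H(1) by (auto simp: subgraph_def)
  obtain u w where uw: "{u, w} \<in> edges G" "u \<in> verts H" "w \<notin> verts H"
    using connected_graph_crossing_edge[OF G(1) v y(1) H(3) y(2)] .
  let ?K = "bridge_join u w H ({w}, {})"
  have "{u, w} \<notin> edges H" using uw(3) simple_graph_edge_ends(3)[OF sim] by blast
  then have "card (verts ?K) = Suc k" "Suc (card (edges ?K)) = Suc k"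
    using k uw(3) simple_graph_finite[OF sim] by simp_all
  moreover have "?K \<in> rooted G v"
    using H uw simple_graph_edge_ends[OF G(2) uw(1)]
      connected_bridge_join[OF H(2) uw(2) connected_graph_singleton, of w w "{}"]
    by (auto simp: mem_rooted_iff subgraph_def)
  ultimately show ?case by blast
qed

lemma spanning_tree_exists:
  assumes G: "connected_graph G" "simple_graph G"
  obtains T where "T \<in> spanning G" "Suc (card T) = card (verts G)"
proof -
  obtain v where v: "v \<in> verts G" using connected_graph_nonempty[OF G(1)] by blast
  then have "1 \<le> card (verts G)"
    using simple_graph_finite(1)[OF G(2)] by (simp add: Suc_le_eq card_gt_0_iff) blast
  then obtain H where H: "H \<in> rooted G v" "card (verts H) = card (verts G)"
    "Suc (card (edges H)) = card (verts G)"
    using subtree_exists[OF G v, of "card (verts G)"] by auto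
  then have "subgraph H G" "connected_graph H" by (simp_all add: mem_rooted_iff)
  moreover from this have "verts H = verts G" using subgraph_order_eq[OF G(2)] H(2) by blast
  ultimately have "edges H \<in> spanning G"
    by (metis (no_types, lifting) mem_Collect_eq prod.collapse spanning_def subgraph_def)
  then show ?thesis using that H(3) by blast
qed

lemma connected_graph_order_le:
  assumes "connected_graph G" "simple_graph G"
  shows "card (verts G) \<le> Suc (card (edges G))"
proof -
  obtain T where "T \<in> spanning G" "Suc (card T) = card (verts G)"
    using spanning_tree_exists[OF assms] .
  moreover from this have "card T \<le> card (edges G)"
    using simple_graph_finite(2)[OF assms(2)] by (intro card_mono) (auto simp: spanning_def)
  ultimately show ?thesis by simp
qed

lemma tree_edge_is_bridge:
  assumes T: "simple_graph (V, T)" "Suc (card T) = card V" and d: "d \<in> T"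
  shows "\<not> connected_graph (V, T - {d})"
proof
  assume "connected_graph (V, T - {d})"
  moreover have "simple_graph (V, T - {d})" using simple_graph_edge_subset[OF T(1)] by simp
  ultimately have "card V \<le> Suc (card (T - {d}))"
    using connected_graph_order_le[of "(V, T - {d})"] by simp
  then show False
    using T(2) card_Suc_Diff1[OF _ d] simple_graph_finite(2)[OF T(1)] by simp
qed

text \<open>The new edge is exchanged for the last edge, at its end x, of a path from y to x.\<close>

lemma edge_exchange:
  assumes G: "connected_graph (V, T)" "simple_graph (V, T)"
    and xy: "x \<in> V" "y \<in> V" "x \<noteq> y" "{x, y} \<notin> T"
  obtains g where "g \<in> T" "x \<in> g" "y \<notin> g" "connected_graph (V, insert {x, y} (T - {g}))"
proof -
  let ?T = "(V, T)" and ?L = "(V, insert {x, y} T)"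
  define C where "C = component (delete_vertex ?T x) y"
  have "C \<subseteq> V - {x}"
    using component_subset[OF simple_graph_delete_vertex[OF G(2)], of y x] xy by (simp add: C_def)
  then have "x \<notin> C" by blast
  moreover have "y \<in> C" by (simp add: C_def component_self)
  ultimately obtain z w where zw: "{z, w} \<in> T" "z \<in> C" "w \<notin> C"
    using connected_graph_crossing_edge[OF G(1), of y x C] xy by auto
  have "z \<noteq> x" using zw(2) \<open>x \<notin> C\<close> by blast
  moreover have "w = x"
  proof (rule ccontr)
    assume "w \<noteq> x"
    then have "{z, w} \<in> edges (delete_vertex ?T x)"
      using zw(1) \<open>z \<noteq> x\<close> by (simp add: edges_delete_vertex[OF G(2)])
    then show False using component_closed[OF zw(2)[unfolded C_def]] zw(3) by (simp add: C_def)
  qed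
  ultimately have g: "{x, z} \<in> T" "{x, z} \<noteq> {x, y}" "y \<notin> {x, z}"
    using zw(1) xy by (auto simp: insert_commute doubleton_eq_iff)
  have "(x, y) \<in> adj (delete_edge ?L {x, z})" using g(2) by (auto simp: in_adj_iff)
  moreover have "(y, z) \<in> (adj (delete_edge ?L {x, z}))\<^sup>*"
  proof -
    have "edges (delete_vertex ?T x) \<subseteq> edges (delete_edge ?L {x, z})"
      by (auto simp: edges_delete_vertex[OF G(2)])
    then show ?thesis using zw(2) adj_rtrancl_mono unfolding C_def component_def by blast
  qed
  ultimately have detour: "(x, z) \<in> (adj (delete_edge ?L {x, z}))\<^sup>*"
    by (rule converse_rtrancl_into_rtrancl)
  have "connected_graph ?L" by (rule connected_graph_mono[OF G(1)]) auto
  then have "connected_graph (delete_edge ?L {x, z})" using detour by (rule connected_delete_edge)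
  moreover have "delete_edge ?L {x, z} = (V, insert {x, y} (T - {{x, z}}))"
    using g(2) by (auto simp: delete_edge_def)
  ultimately show ?thesis using that g by simp
qed

text \<open>Of the two trees that exchange f for an edge of T, neither stays connected without f.\<close>

lemma card_spanning_edge:
  assumes G: "simple_graph G" and f: "f \<in> edges G"
    and T: "T \<in> spanning (delete_edge G f)" "Suc (card T) = card (verts G)"
  shows "2 * card (spanning (delete_edge G f)) + 2 \<le> card (spanning G)"
proof -
  let ?S = "spanning (delete_edge G f)"
  have TE: "T \<subseteq> edges G" "f \<notin> T" "connected_graph (verts G, T)"
    using T(1) by (auto simp: spanning_def)
  have simT: "simple_graph (verts G, T)" by (rule simple_graph_edge_subset[OF G TE(1)])
  obtain x y where xy: "f = {x, y}" "x \<noteq> y" "x \<in> verts G" "y \<in> verts G"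
    using simple_graph_edgeE[OF G f] .
  obtain g where g: "g \<in> T" "x \<in> g" "y \<notin> g" "connected_graph (verts G, insert f (T - {g}))"
    using edge_exchange[OF TE(3) simT xy(3,4,2)] TE(2) xy(1) by metis
  obtain h where h: "h \<in> T" "y \<in> h" "x \<notin> h" "connected_graph (verts G, insert f (T - {h}))"
    using edge_exchange[OF TE(3) simT xy(4,3)] TE(2) xy(1,2) by (metis insert_commute)
  let ?swaps = "{insert f (T - {g}), insert f (T - {h})}"
  have new: "insert f (T - {d}) \<notin> ?S \<union> insert f ` ?S" if "d \<in> T" for d
  proof
    assume "insert f (T - {d}) \<in> ?S \<union> insert f ` ?S"
    then obtain D where D: "D \<in> ?S" "insert f (T - {d}) = insert f D"
      by (auto simp: spanning_def)
    then have "T - {d} = D" using TE(2) by (auto simp: spanning_def)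
    then show False using D(1) tree_edge_is_bridge[OF simT T(2) that] by (simp add: spanning_def)
  qed
  have "?S \<union> insert f ` ?S \<union> ?swaps \<subseteq> spanning G"
    using f g h TE(1) by (auto simp: spanning_def intro: connected_graph_mono)
  then have "card (?S \<union> insert f ` ?S \<union> ?swaps) \<le> card (spanning G)"
    by (rule card_mono[OF finite_spanning[OF G]])
  moreover have "finite ?S" by (rule finite_spanning[OF simple_graph_delete_edge[OF G]])
  moreover have "inj_on (insert f) ?S"
    by (rule inj_on_inverseI[of _ "\<lambda>D. D - {f}"]) (auto simp: spanning_def)
  moreover have "?S \<inter> insert f ` ?S = {}" by (auto simp: spanning_def)
  ultimately have "2 * card ?S + card ?swaps \<le> card (spanning G)"
    using new[OF g(1)] new[OF h(1)]
    by (subst (asm) card_Un_disjoint) (auto simp: card_Un_disjoint card_image)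
  moreover have "insert f (T - {g}) \<noteq> insert f (T - {h})"
    using TE(2) g h by blast
  ultimately show ?thesis by simp
qed

lemma card_spanning_ge:
  assumes "connected_graph G" "simple_graph G" "card (verts G) + c \<le> Suc (card (edges G))"
  shows "3 * 2 ^ c \<le> card (spanning G) + 2"
  using assms
proof (induction c arbitrary: G)
  case 0
  then have "edges G \<in> spanning G" by (simp add: spanning_def)
  then have "1 \<le> card (spanning G)"
    using finite_spanning[OF "0.prems"(2)] by (simp add: Suc_le_eq card_gt_0_iff) blast
  then show ?case by simp
next
  case (Suc c)
  note G = Suc.prems(1,2)
  obtain T where T: "T \<in> spanning G" "Suc (card T) = card (verts G)"
    using spanning_tree_exists[OF G] .
  then have "T \<noteq> edges G" using Suc.prems(3) by auto
  then obtain f where f: "f \<in> edges G" "f \<notin> T" using T(1) by (auto simp: spanning_def)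
  let ?G = "delete_edge G f"
  have T': "T \<in> spanning ?G" using T(1) f(2) by (auto simp: spanning_def)
  then have "connected_graph ?G"
    by (intro connected_graph_mono[of "(verts G, T)" ?G]) (simp_all add: spanning_def)
  moreover have "card (verts ?G) + c \<le> Suc (card (edges ?G))"
    using Suc.prems(3) card_edges_delete_edge[OF G(2) f(1)] by simp
  ultimately have "3 * 2 ^ c \<le> card (spanning ?G) + 2"
    using Suc.IH simple_graph_delete_edge[OF G(2)] by blast
  then show ?case using card_spanning_edge[OF G(2) f(1) T' T(2)] by simp
qed

lemma card_nonspanning_ge:
  assumes G: "connected_graph G" "simple_graph G" "v \<in> verts G"
  shows "card (verts G) \<le> Suc (card (nonspanning G v))"
    and "2 \<le> degree G v \<Longrightarrow> card (verts G) \<le> card (nonspanning G v)"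
proof -
  let ?n = "card (verts G)" and ?N = "nonspanning G v" and ?ord = "\<lambda>H. card (verts H)"
  have fin: "finite ?N" by (rule finite_nonspanning[OF G(2)])
  have orders: "{1..<?n} \<subseteq> ?ord ` ?N"
  proof
    fix k assume k: "k \<in> {1..<?n}"
    then obtain H where "H \<in> rooted G v" "?ord H = k" using subtree_exists[OF G, of k] by auto
    moreover from this have "H \<in> ?N" using k by (auto simp: nonspanning_def)
    ultimately show "k \<in> ?ord ` ?N" by blast
  qed
  then have orders_le: "?n - 1 \<le> card (?ord ` ?N)"
    using card_mono[OF finite_imageI[OF fin] orders] by simp
  then show "?n \<le> Suc (card ?N)" using card_image_le[OF fin, of ?ord] by linarith
  assume "2 \<le> degree G v"
  then obtain x y where xy: "{v, x} \<in> edges G" "{v, y} \<in> edges G" "x \<noteq> y"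
    using two_neighbours[OF G(2)] by metis
  have ends: "v \<noteq> x" "v \<noteq> y" "x \<in> verts G" "y \<in> verts G"
    using simple_graph_edge_ends[OF G(2)] xy by blast+
  have edge_at_root: "?ord ({v, w}, {{v, w}}) = 2 \<and> ({v, w}, {{v, w}}) \<in> ?N"
    if w: "w \<in> {x, y}" for w
  proof -
    have "{v, w} \<noteq> verts G" using w xy(3) ends by auto
    moreover have "connected_graph ({v, w}, {{v, w}})"
      using connected_bridge_join[OF connected_graph_singleton _ connected_graph_singleton,
          of v v "{}" w w "{}"]
      by (simp add: bridge_join_def insert_commute)
    ultimately show ?thesis
      using w xy ends G(3) by (auto simp: nonspanning_def mem_rooted_iff subgraph_def)
  qed
  have "\<not> inj_on ?ord ?N"
  proof
    assume "inj_on ?ord ?N"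
    then have "({v, x}, {{v, x}}) = ({v, y}, {{v, y}})"
      using edge_at_root[of x] edge_at_root[of y] by (intro inj_onD[of ?ord ?N]) simp_all
    then show False using xy(3) by (auto simp: doubleton_eq_iff)
  qed
  then have "card (?ord ` ?N) \<noteq> card ?N" using eq_card_imp_inj_on[OF fin] by blast
  then show "?n \<le> card ?N" using orders_le card_image_le[OF fin, of ?ord] by linarith
qed

lemma card_verts_le_card_rooted:
  assumes "connected_graph G" "simple_graph G" "v \<in> verts G"
  shows "card (verts G) \<le> card (rooted G v)"
  using card_nonspanning_ge(1)[OF assms] card_spanning_ge[OF assms(1,2), of 0]
    connected_graph_order_le[OF assms(1,2)] card_rooted_eq[OF assms(2,3)] by simp

lemma card_component_le_card_rooted:
  assumes G: "simple_graph G" and v: "v \<in> verts G"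
  shows "card (component G v) \<le> card (rooted G v)"
proof -
  let ?C = "induced G (component G v)"
  have sub: "subgraph ?C G" by (rule subgraph_induced[OF component_subset[OF G v]])
  have "card (verts ?C) \<le> card (rooted ?C v)"
    using simple_graph_subgraph[OF G sub]
    by (intro card_verts_le_card_rooted connected_induced_component) (simp_all add: component_self)
  then show ?thesis using card_meeting_mono[OF G sub, of "{v}"] by simp
qed

section \<open>Joining two graphs by a bridge\<close>

definition graph_inter :: "'a ugraph \<Rightarrow> 'a ugraph \<Rightarrow> 'a ugraph" where
  "graph_inter G H = (verts G \<inter> verts H, edges G \<inter> edges H)"

locale bridge =
  fixes A B :: "'a ugraph" and v a :: 'a
  assumes simple_sides: "simple_graph A" "simple_graph B"
    and ends: "v \<in> verts A" "a \<in> verts B"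
    and disjoint: "verts A \<inter> verts B = {}"
begin

abbreviation joined :: "'a ugraph" where
  "joined \<equiv> bridge_join v a A B"

lemma flip: "bridge B A a v"
  using simple_sides ends disjoint by unfold_locales auto

lemma edge_in_side:
  shows "e \<in> edges A \<Longrightarrow> e \<noteq> {} \<and> e \<subseteq> verts A" "e \<in> edges B \<Longrightarrow> e \<noteq> {} \<and> e \<subseteq> verts B"
  using simple_sides by (auto simp: simple_graph_def)

lemma simple_joined: "simple_graph joined"
proof -
  have "v \<noteq> a" using ends disjoint by blast
  then show ?thesis using simple_sides ends by (auto simp: simple_graph_def)
qed

lemma subgraph_sides: "subgraph A joined" "subgraph B joined"
  using edge_in_side by (auto simp: subgraph_def)

lemma order_joined: "card (verts joined) = card (verts A) + card (verts B)"
  using simple_sides disjoint by (simp add: card_Un_disjoint simple_graph_finite(1))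

lemma size_joined: "card (edges joined) = Suc (card (edges A) + card (edges B))"
proof -
  have "edges A \<inter> edges B = {}" "{v, a} \<notin> edges A \<union> edges B"
    using edge_in_side disjoint ends by blast+
  then show ?thesis using simple_sides by (simp add: card_Un_disjoint simple_graph_finite(2))
qed

lemma bridge_edge_used:
  assumes H: "H \<in> conn_subgraphs joined" "verts H \<inter> verts A \<noteq> {}" "verts H \<inter> verts B \<noteq> {}"
  shows "{v, a} \<in> edges H"
proof -
  obtain x y where xy: "x \<in> verts H" "y \<in> verts H" "x \<in> verts A" "y \<notin> verts A"
    using H(2,3) disjoint by blast
  obtain u w where uw: "{u, w} \<in> edges H" "u \<in> verts A" "w \<notin> verts A"
    using connected_graph_crossing_edge[OF conn_subgraphsD(2)[OF H(1)] xy] .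
  then have "{u, w} \<in> edges joined"
    using conn_subgraphsD(1)[OF H(1)] by (auto simp: subgraph_def)
  moreover have "{u, w} \<notin> edges A" "{u, w} \<notin> edges B"
    using uw(2,3) edge_in_side[of "{u, w}"] disjoint by auto
  ultimately show ?thesis using uw(1) by simp
qed

text \<open>Collapsing the side of B onto v maps the connected subgraph onto its part in A.\<close>

lemma graph_inter_rooted:
  assumes H: "H \<in> conn_subgraphs joined" and va: "{v, a} \<in> edges H"
  shows "graph_inter A H \<in> rooted A v"
proof -
  have sub: "subgraph H joined" "connected_graph H" using conn_subgraphsD[OF H] .
  then have v: "v \<in> verts (graph_inter A H)"
    using va ends by (auto simp: graph_inter_def subgraph_def)
  have "connected_graph (graph_inter A H)"
  proof (rule connected_graph_map[where f = "\<lambda>x. if x \<in> verts A then x else v", OF sub(2)])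
    show "(\<lambda>x. if x \<in> verts A then x else v) ` verts H = verts (graph_inter A H)"
      using v by (auto simp: graph_inter_def)
    fix x y assume xy: "{x, y} \<in> edges H"
    then consider (left) "{x, y} \<in> edges A" | (right) "{x, y} \<in> edges B"
      | (bridge) "{x, y} = {v, a}"
      using sub(1) by (auto simp: subgraph_def)
    then show "(if x \<in> verts A then x else v, if y \<in> verts A then y else v)
        \<in> (adj (graph_inter A H))\<^sup>*"
    proof cases
      case left
      then have "(x, y) \<in> adj (graph_inter A H)" using xy by (simp add: in_adj_iff graph_inter_def)
      then show ?thesis using edge_in_side(1)[OF left] by auto
    next
      case right
      then have "x \<notin> verts A" "y \<notin> verts A" using edge_in_side(2)[OF right] disjoint by auto
      then show ?thesis by simp
    next
      case bridge
      then show ?thesis using ends disjoint by (auto simp: doubleton_eq_iff)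
    qed
  qed
  moreover have "subgraph (graph_inter A H) A"
    using sub(1) edge_in_side(1) by (fastforce simp: graph_inter_def subgraph_def)
  ultimately show ?thesis using v by (simp add: mem_rooted_iff)
qed

lemma conn_subgraph_of_side:
  assumes H: "H \<in> conn_subgraphs joined" and B: "verts H \<inter> verts B = {}"
  shows "H \<in> conn_subgraphs A"
proof -
  have sub: "subgraph H joined" using conn_subgraphsD(1)[OF H] .
  then have verts: "verts H \<subseteq> verts A" using B by (auto simp: subgraph_def)
  have "e \<in> edges A" if "e \<in> edges H" for e
  proof -
    have "e \<subseteq> verts A" "e \<in> edges joined" using that sub verts unfolding subgraph_def by blast+
    then show ?thesis using edge_in_side(2)[of e] ends disjoint by auto
  qed
  then show ?thesis
    using sub verts conn_subgraphsD(2)[OF H] by (auto simp: conn_subgraphs_def subgraph_def)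
qed

lemma bridge_join_of_graph_inter:
  assumes H: "H \<in> conn_subgraphs joined" and va: "{v, a} \<in> edges H"
  shows "H = bridge_join v a (graph_inter A H) (graph_inter B H)"
  using conn_subgraphsD(1)[OF H] va
  by (auto simp: graph_inter_def bridge_join_def subgraph_def prod_eq_iff)

lemma bridge_join_rooted:
  assumes "H \<in> rooted A v" "H' \<in> rooted B a"
  shows "bridge_join v a H H' \<in> conn_subgraphs joined"
    and "graph_inter A (bridge_join v a H H') = H" "graph_inter B (bridge_join v a H H') = H'"
proof -
  have sub: "subgraph H A" "connected_graph H" "v \<in> verts H"
    "subgraph H' B" "connected_graph H'" "a \<in> verts H'"
    using assms by (simp_all add: mem_rooted_iff)
  show "bridge_join v a H H' \<in> conn_subgraphs joined"
    using sub connected_bridge_join[OF sub(2,3,5,6)] by (auto simp: conn_subgraphs_def subgraph_def)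
  have "edges A \<inter> edges B = {}" "{v, a} \<notin> edges A" "{v, a} \<notin> edges B"
    using edge_in_side disjoint ends by blast+
  then show "graph_inter A (bridge_join v a H H') = H" "graph_inter B (bridge_join v a H H') = H'"
    using sub(1,4) disjoint by (auto simp: graph_inter_def subgraph_def prod_eq_iff)
qed

lemma conn_subgraphs_joined:
  "conn_subgraphs joined = conn_subgraphs A \<union> conn_subgraphs B
    \<union> (\<lambda>(H, H'). bridge_join v a H H') ` (rooted A v \<times> rooted B a)" (is "_ = _ \<union> ?joins")
proof
  show "conn_subgraphs joined \<subseteq> conn_subgraphs A \<union> conn_subgraphs B \<union> ?joins"
  proof
    fix H assume H: "H \<in> conn_subgraphs joined"
    consider (in_B) "verts H \<inter> verts A = {}" | (in_A) "verts H \<inter> verts B = {}"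
      | (bridge) "{v, a} \<in> edges H"
      using bridge_edge_used[OF H] by blast
    then show "H \<in> conn_subgraphs A \<union> conn_subgraphs B \<union> ?joins"
    proof cases
      case in_B
      then show ?thesis
        using bridge.conn_subgraph_of_side[OF flip] H bridge_join_commute[of v a A B] by simp
    next
      case in_A
      then show ?thesis using conn_subgraph_of_side[OF H] by simp
    next
      case bridge
      moreover have "graph_inter B H \<in> rooted B a"
        using bridge.graph_inter_rooted[OF flip, of H] H bridge bridge_join_commute[of v a A B]
        by (simp add: insert_commute)
      ultimately show ?thesis
        using bridge_join_of_graph_inter[OF H] graph_inter_rooted[OF H]
        by (intro UnI2 image_eqI[of _ _ "(graph_inter A H, graph_inter B H)"]) simp_all
    qed
  qed
  have "?joins \<subseteq> conn_subgraphs joined" by (auto intro: bridge_join_rooted(1))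
  then show "conn_subgraphs A \<union> conn_subgraphs B \<union> ?joins \<subseteq> conn_subgraphs joined"
    using subgraph_sides[THEN conn_subgraphs_mono] by simp
qed

lemma card_joins:
  "card ((\<lambda>(H, H'). bridge_join v a H H') ` (rooted A v \<times> rooted B a))
    = card (rooted A v) * card (rooted B a)"
proof -
  have "inj_on (\<lambda>(H, H'). bridge_join v a H H') (rooted A v \<times> rooted B a)"
    by (rule inj_on_inverseI[of _ "\<lambda>K. (graph_inter A K, graph_inter B K)"])
      (auto simp: bridge_join_rooted(2,3))
  then show ?thesis by (simp add: card_image card_cartesian_product)
qed

lemma core_index_joined:
  "core_index joined = core_index A + core_index B + card (rooted A v) * card (rooted B a)"
proof -
  let ?joins = "(\<lambda>(H, H'). bridge_join v a H H') ` (rooted A v \<times> rooted B a)"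
  have "verts H \<subseteq> verts C \<and> verts H \<noteq> {}" if "H \<in> conn_subgraphs C" for H C :: "'a ugraph"
    using conn_subgraphsD[OF that] connected_graph_nonempty[of H] by (auto simp: subgraph_def)
  then have "conn_subgraphs A \<inter> conn_subgraphs B = {}" using disjoint by blast
  moreover have "(conn_subgraphs A \<union> conn_subgraphs B) \<inter> ?joins = {}"
  proof -
    have "{v, a} \<notin> edges H" if "H \<in> conn_subgraphs A \<union> conn_subgraphs B" for H
      using that edge_in_side[of "{v, a}"] ends disjoint
      by (auto simp: conn_subgraphs_def subgraph_def)
    moreover have "{v, a} \<in> edges H" if "H \<in> ?joins" for H using that by auto
    ultimately show ?thesis by blast
  qed
  ultimately show ?thesis
    using finite_conn_subgraphs[OF simple_joined]
    by (simp add: core_index_eq conn_subgraphs_joined card_Un_disjoint card_joins)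
qed

lemma card_rooted_joined: "card (rooted joined v) = card (rooted A v) * Suc (card (rooted B a))"
proof -
  let ?joins = "(\<lambda>(H, H'). bridge_join v a H H') ` (rooted A v \<times> rooted B a)"
  have "v \<notin> verts H" if "H \<in> conn_subgraphs B" for H
    using that ends disjoint by (auto simp: conn_subgraphs_def subgraph_def)
  moreover have "v \<in> verts H" if "H \<in> ?joins" for H
    using that by (auto simp: mem_rooted_iff)
  ultimately have "rooted joined v = rooted A v \<union> ?joins"
    using rooted_eq[of joined v] rooted_eq[of A v] unfolding conn_subgraphs_joined by blast
  moreover have "rooted A v \<inter> ?joins = {}"
  proof -
    have "a \<notin> verts H" if "H \<in> rooted A v" for H
      using that ends disjoint by (auto simp: mem_rooted_iff subgraph_def)
    moreover have "a \<in> verts H" if "H \<in> ?joins" for H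
      using that by (auto simp: mem_rooted_iff)
    ultimately show ?thesis by blast
  qed
  ultimately show ?thesis
    using finite_meeting[OF simple_joined, of "{v}"] by (simp add: card_Un_disjoint card_joins)
qed

lemma card_meeting_ends_ge:
  "card (rooted A v) + card (rooted B a) \<le> card (meeting (delete_edge joined {v, a}) {v, a})"
proof -
  let ?K = "delete_edge joined {v, a}"
  have K: "simple_graph ?K" by (rule simple_graph_delete_edge[OF simple_joined])
  have "{v, a} \<notin> edges A \<union> edges B" using edge_in_side disjoint ends by blast
  then have sub: "subgraph A ?K" "subgraph B ?K"
    using subgraph_sides by (auto simp: subgraph_def)
  have "v \<notin> verts B" using ends(1) disjoint by blast
  moreover from this have "v \<notin> e" if "e \<in> edges B" for e using edge_in_side(2)[OF that] by blast
  ultimately have "subgraph B (delete_vertex ?K v)"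
    using sub(2) edge_in_side(2) by (auto simp: subgraph_def edges_delete_vertex[OF K])
  then show ?thesis
    using card_meeting_mono[OF K sub(1), of "{v}"] card_meeting_insert[OF K, of v "{a}"]
      card_meeting_mono[OF simple_graph_delete_vertex[OF K], of B v "{a}"] by linarith
qed

end

lemma conn_subgraphs_singleton: "conn_subgraphs ({v}, {}) = {({v}, {})}"
  by (auto simp: conn_subgraphs_def subgraph_def connected_graph_def)

lemma core_index_singleton: "core_index ({v}, {}) = 1"
  by (simp add: core_index_eq conn_subgraphs_singleton)

lemma card_rooted_singleton: "card (rooted ({v}, {}) v) = 1"
proof -
  have "rooted ({v}, {}) v = {({v}, {})}" by (auto simp: meeting_def conn_subgraphs_singleton)
  then show ?thesis by simp
qed

lemma simple_graph_singleton: "simple_graph ({v}, {})"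
  by (simp add: simple_graph_def)

lemma card_rooted_degree_one:
  assumes G: "simple_graph G" and deg: "degree G v = 1" and vx: "{v, x} \<in> edges G"
  shows "card (rooted G v) = Suc (card (rooted (delete_vertex G v) x))"
proof -
  have ends: "v \<noteq> x" "v \<in> verts G" "x \<in> verts G" using simple_graph_edge_ends[OF G vx] .
  obtain y where y: "{e \<in> edges G. v \<in> e} = {{v, y}}"
    using degree_one_neighbour[OF G deg] .
  have "{v, x} \<in> {e \<in> edges G. v \<in> e}" using vx by simp
  then have "{e \<in> edges G. v \<in> e} = {{v, x}}" unfolding y by simp
  then have "edges G = insert {v, x} {e \<in> edges G. v \<notin> e}" by blast
  then have join: "G = bridge_join v x ({v}, {}) (delete_vertex G v)"
    using ends(2) by (auto simp: prod_eq_iff edges_delete_vertex[OF G])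
  interpret bridge "({v}, {})" "delete_vertex G v" v x
    using simple_graph_delete_vertex[OF G] ends
    by unfold_locales (auto simp: simple_graph_singleton)
  show ?thesis
    using card_rooted_joined unfolding join[symmetric] by (simp add: card_rooted_singleton)
qed

lemma card_rooted_ge:
  assumes "connected_graph G" "simple_graph G" "v \<in> verts G"
    and "c > 0" "card (verts G) + c \<le> Suc (card (edges G))"
  shows "card (verts G) + 3 * 2 ^ c \<le> card (rooted G v) + 2"
  using assms
proof (induction "card (verts G)" arbitrary: G v)
  case 0
  then show ?case using simple_graph_finite(1) by fastforce
next
  case (Suc n)
  note G = Suc.prems(1,2) and v = Suc.prems(3)
  have size: "edges G \<noteq> {}" using Suc.hyps(2) Suc.prems(4,5) by auto
  show ?case
  proof (cases "degree G v = 1")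
    case True
    obtain x where x: "{e \<in> edges G. v \<in> e} = {{v, x}}" "x \<noteq> v" "x \<in> verts G"
      using degree_one_neighbour[OF G(2) True] .
    let ?G = "delete_vertex G v"
    have "Suc (card (verts ?G)) = card (verts G)" "Suc (card (edges ?G)) = card (edges G)"
      using card_verts_delete_vertex[OF G(2) v] card_edges_delete_vertex[OF G(2), of v] True
      by simp_all
    then have "card (verts ?G) + 3 * 2 ^ c \<le> card (rooted ?G x) + 2"
      using Suc.hyps(1)[of ?G x] Suc.hyps(2) Suc.prems(4,5) x(2,3)
        connected_delete_degree_one[OF G True] simple_graph_delete_vertex[OF G(2)] by simp
    moreover have "card (rooted G v) = Suc (card (rooted ?G x))"
      using x(1) by (intro card_rooted_degree_one[OF G(2) True]) blast
    ultimately show ?thesis using \<open>Suc (card (verts ?G)) = card (verts G)\<close> by simp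
  next
    case False
    obtain x y where "x \<noteq> y" "x \<in> verts G" "y \<in> verts G"
      using size simple_graph_edgeE[OF G(2)] by blast
    then have "2 \<le> card (verts G)"
      using card_mono[OF simple_graph_finite(1)[OF G(2)], of "{x, y}"] by simp
    then have "2 \<le> degree G v" using degree_pos[OF G v] False by linarith
    then show ?thesis
      using card_nonspanning_ge(2)[OF G v] card_spanning_ge[OF G Suc.prems(5)]
        card_rooted_eq[OF G(2) v]
      by linarith
  qed
qed

section \<open>Contracting an edge\<close>

definition merge :: "'a \<Rightarrow> 'a \<Rightarrow> 'a \<Rightarrow> 'a" where
  "merge v a x = (if x = a then v else x)"

definition contract :: "'a ugraph \<Rightarrow> 'a \<Rightarrow> 'a \<Rightarrow> 'a ugraph" where
  "contract G v a = (verts G - {a}, (`) (merge v a) ` (edges G - {{v, a}}))"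

definition in_triangle :: "'a ugraph \<Rightarrow> 'a \<Rightarrow> 'a \<Rightarrow> bool" where
  "in_triangle G v a \<longleftrightarrow> (\<exists>c. {v, c} \<in> edges G \<and> {a, c} \<in> edges G)"

lemma verts_contract [simp]: "verts (contract G v a) = verts G - {a}"
  by (simp add: contract_def)

lemma edges_contract: "edges (contract G v a) = (`) (merge v a) ` (edges G - {{v, a}})"
  by (simp add: contract_def)

lemma merge_image: "merge v a ` e = (if a \<in> e then insert v (e - {a}) else e)"
  by (auto simp: merge_def)

lemma connected_contract:
  assumes con: "connected_graph G" and ends: "v \<noteq> a" "v \<in> verts G"
  shows "connected_graph (contract G v a)"
proof (rule connected_graph_map[where f = "merge v a", OF con])
  show "merge v a ` verts G = verts (contract G v a)"
    using ends by (auto simp: merge_image)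
  fix x y assume xy: "{x, y} \<in> edges G"
  show "(merge v a x, merge v a y) \<in> (adj (contract G v a))\<^sup>*"
  proof (cases "{x, y} = {v, a}")
    case True
    then show ?thesis by (auto simp: merge_def doubleton_eq_iff)
  next
    case False
    then have "merge v a ` {x, y} \<in> edges (contract G v a)"
      unfolding edges_contract using xy by blast
    then show ?thesis by (simp add: in_adj_iff r_into_rtrancl)
  qed
qed

locale contraction =
  fixes G :: "'a ugraph" and v a :: 'a
  assumes simple: "simple_graph G" and edge: "{v, a} \<in> edges G"
    and no_triangle: "\<not> in_triangle G v a"
begin

lemma ends: "v \<noteq> a" "v \<in> verts G" "a \<in> verts G"
  using simple_graph_edge_ends[OF simple edge] .

lemma edge_at_a:
  assumes "e \<in> edges G - {{v, a}}" "a \<in> e"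
  obtains x where "e = {a, x}" "x \<noteq> a" "x \<noteq> v" "{v, x} \<notin> edges G"
proof -
  obtain x where x: "e = {a, x}" "a \<noteq> x"
    by (rule simple_graph_edge_atE[OF simple _ assms(2)]) (use assms(1) in auto)
  moreover have "x \<noteq> v" using assms(1) x(1) by (auto simp: insert_commute)
  moreover have "{v, x} \<notin> edges G" using no_triangle assms(1) x(1) by (auto simp: in_triangle_def)
  ultimately show ?thesis using that by blast
qed

lemma inj_on_merge_edges: "inj_on ((`) (merge v a)) (edges G - {{v, a}})"
proof (rule inj_onI)
  have mixed: False if e: "e \<in> edges G - {{v, a}}" "d \<in> edges G - {{v, a}}" "a \<in> e" "a \<notin> d"
    and eq: "merge v a ` e = merge v a ` d" for e d
  proof -
    obtain x where x: "e = {a, x}" "x \<noteq> a" "{v, x} \<notin> edges G" using edge_at_a[OF e(1,3)] by blast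
    have "merge v a ` e = {v, x}" using x(1,2) by (auto simp: merge_def)
    moreover have "merge v a ` d = d" using e(4) by (simp add: merge_image)
    ultimately have "d = {v, x}" using eq by simp
    then show False using x(3) e(2) by simp
  qed
  fix e d assume e: "e \<in> edges G - {{v, a}}" and d: "d \<in> edges G - {{v, a}}"
    and eq: "merge v a ` e = merge v a ` d"
  then consider (both) "a \<in> e" "a \<in> d" | (neither) "a \<notin> e" "a \<notin> d"
    using mixed[OF e d _ _ eq] mixed[OF d e _ _ eq[symmetric]] by blast
  then show "e = d"
  proof cases
    case both
    have "v \<notin> e" "v \<notin> d" using edge_at_a[OF e both(1)] edge_at_a[OF d both(2)] ends(1) by blast+
    then have "e - {a} = d - {a}" using eq both by (simp add: merge_image insert_ident)
    then show ?thesis using both by blast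
  qed (use eq in \<open>simp add: merge_image\<close>)
qed

lemma simple_contract: "simple_graph (contract G v a)"
proof -
  have "merge v a ` e \<subseteq> verts G - {a} \<and> card (merge v a ` e) = 2"
    if e: "e \<in> edges G - {{v, a}}" for e
  proof (cases "a \<in> e")
    case True
    then obtain x where "e = {a, x}" "x \<noteq> a" "x \<noteq> v" using edge_at_a[OF e] by blast
    moreover have "x \<in> verts G" using simple_graph_edge_ends(3)[OF simple] e calculation(1) by blast
    moreover have "merge v a ` e = {v, x}" using calculation(1,2) by (auto simp: merge_def)
    ultimately show ?thesis using ends by simp
  next
    case False
    then show ?thesis using e simple by (auto simp: merge_image simple_graph_def)
  qed
  then show ?thesis
    using simple_graph_finite(1)[OF simple] by (simp add: simple_graph_def edges_contract)
qed

lemma card_contract: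
  "Suc (card (verts (contract G v a))) = card (verts G)"
  "Suc (card (edges (contract G v a))) = card (edges G)"
  using card_Suc_Diff1[OF simple_graph_finite(1)[OF simple] ends(3)]
    card_Suc_Diff1[OF simple_graph_finite(2)[OF simple] edge]
  by (simp_all add: edges_contract card_image[OF inj_on_merge_edges])

definition expand :: "'a ugraph \<Rightarrow> 'a ugraph" where
  "expand H = (insert a (verts H),
    insert {v, a} {e \<in> edges G - {{v, a}}. merge v a ` e \<in> edges H})"

lemma contract_conn_subgraph:
  assumes H: "H \<in> conn_subgraphs G" and va: "{v, a} \<in> edges H"
  shows "contract H v a \<in> rooted (contract G v a) v"
proof -
  have sub: "subgraph H G" "connected_graph H" using conn_subgraphsD[OF H] .
  have v: "v \<in> verts H" "a \<in> verts H" using sub(1) va by (auto simp: subgraph_def)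
  have "merge v a ` e \<subseteq> verts H - {a}" if "e \<in> edges H" for e
  proof -
    have "e \<subseteq> verts H" using that sub(1) by (simp add: subgraph_def)
    then show ?thesis using v(1) ends(1) by (auto simp: merge_def)
  qed
  moreover have "edges (contract H v a) \<subseteq> edges (contract G v a)"
    unfolding edges_contract using sub(1) by (intro image_mono) (auto simp: subgraph_def)
  moreover have "verts H - {a} \<subseteq> verts G - {a}" using sub(1) by (auto simp: subgraph_def)
  ultimately have "subgraph (contract H v a) (contract G v a)"
    by (simp add: subgraph_def edges_contract)
  then show ?thesis
    using connected_contract[OF sub(2) ends(1) v(1)] v ends(1) by (simp add: mem_rooted_iff)
qed

lemma connected_expand:
  assumes H: "H \<in> rooted (contract G v a) v"
  shows "connected_graph (expand H)"
proof (rule connected_graph_from_root)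
  have sub: "subgraph H (contract G v a)" "connected_graph H" "v \<in> verts H"
    using H by (simp_all add: mem_rooted_iff)
  show "v \<in> verts (expand H)" using sub(3) by (simp add: expand_def)
  have va: "(v, a) \<in> adj (expand H)" by (simp add: in_adj_iff expand_def)
  then have to_merge: "(x, merge v a x) \<in> (adj (expand H))\<^sup>*" for x
    using adj_rtrancl_sym[OF r_into_rtrancl[OF va]] by (simp add: merge_def)
  have "(p, q) \<in> (adj (expand H))\<^sup>*" if "(p, q) \<in> adj H" for p q
  proof -
    have pq: "{p, q} \<in> edges H" using that by (simp add: in_adj_iff)
    moreover have "edges H \<subseteq> (`) (merge v a) ` (edges G - {{v, a}})"
      using sub(1) by (simp add: subgraph_def edges_contract)
    ultimately obtain e where e: "e \<in> edges G - {{v, a}}" "{p, q} = merge v a ` e" by blast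
    obtain x y where xy: "e = {x, y}" using simple_graph_edgeE[OF simple] e(1) by blast
    have path: "(merge v a x, merge v a y) \<in> (adj (expand H))\<^sup>*"
    proof -
      have "(x, y) \<in> adj (expand H)" using e pq xy by (simp add: in_adj_iff expand_def)
      then show ?thesis
        using to_merge[of y] adj_rtrancl_sym[OF to_merge[of x]]
        by (meson rtrancl_into_rtrancl rtrancl_trans)
    qed
    have "p = merge v a x \<and> q = merge v a y \<or> p = merge v a y \<and> q = merge v a x"
      using e(2) xy by (simp add: doubleton_eq_iff)
    then show ?thesis using path adj_rtrancl_sym[OF path] by blast
  qed
  then have "(adj H)\<^sup>* \<subseteq> (adj (expand H))\<^sup>*" by (intro rtrancl_subset_rtrancl) auto
  then have "(v, x) \<in> (adj (expand H))\<^sup>*" if "x \<in> verts H" for x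
    using sub(2,3) that by (auto simp: connected_graph_def)
  then show "(v, x) \<in> (adj (expand H))\<^sup>*" if "x \<in> verts (expand H)" for x
    using that va by (auto simp: expand_def)
qed

lemma expand_conn_subgraph:
  assumes H: "H \<in> rooted (contract G v a) v"
  shows "expand H \<in> conn_subgraphs G"
proof -
  have sub: "subgraph H (contract G v a)" "v \<in> verts H" using H by (simp_all add: mem_rooted_iff)
  have "e \<subseteq> insert a (verts H)" if "merge v a ` e \<in> edges H" for e
  proof -
    have "merge v a ` e \<subseteq> verts H" using that sub(1) by (simp add: subgraph_def)
    then show ?thesis by (auto simp: merge_image split: if_splits)
  qed
  then have "subgraph (expand H) G"
    using sub edge ends by (auto simp: subgraph_def expand_def)
  then show ?thesis using connected_expand[OF H] by (simp add: conn_subgraphs_def)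
qed

lemma contract_expand:
  assumes H: "H \<in> rooted (contract G v a) v"
  shows "contract (expand H) v a = H"
proof -
  have sub: "verts H \<subseteq> verts G - {a}" "edges H \<subseteq> (`) (merge v a) ` (edges G - {{v, a}})"
    using H by (simp_all add: mem_rooted_iff subgraph_def edges_contract)
  have "edges (expand H) - {{v, a}} = {e \<in> edges G - {{v, a}}. merge v a ` e \<in> edges H}"
    by (auto simp: expand_def)
  then have "edges (contract (expand H) v a)
      = (`) (merge v a) ` {e \<in> edges G - {{v, a}}. merge v a ` e \<in> edges H}"
    by (simp only: edges_contract)
  also have "\<dots> = edges H" using sub(2) by blast
  finally have "edges (contract (expand H) v a) = edges H" .
  moreover have "verts (contract (expand H) v a) = verts H"
    using sub(1) by (auto simp: expand_def)
  ultimately show ?thesis by (simp add: prod_eq_iff)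
qed

lemma expand_contract:
  assumes H: "H \<in> conn_subgraphs G" and va: "{v, a} \<in> edges H"
  shows "expand (contract H v a) = H"
proof -
  have sub: "subgraph H G" using conn_subgraphsD(1)[OF H] .
  then have H_edges: "edges H - {{v, a}} \<subseteq> edges G - {{v, a}}" by (auto simp: subgraph_def)
  have "merge v a ` e \<in> edges (contract H v a) \<longleftrightarrow> e \<in> edges H - {{v, a}}"
    if "e \<in> edges G - {{v, a}}" for e
    unfolding edges_contract by (rule inj_on_image_mem_iff[OF inj_on_merge_edges that H_edges])
  then have "{e \<in> edges G - {{v, a}}. merge v a ` e \<in> edges (contract H v a)} = edges H - {{v, a}}"
    using H_edges by blast
  moreover have "a \<in> verts H" using sub va by (auto simp: subgraph_def)
  ultimately show ?thesis using va by (auto simp: expand_def prod_eq_iff)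
qed

lemma card_conn_subgraphs_edge:
  "card {H \<in> conn_subgraphs G. {v, a} \<in> edges H} = card (rooted (contract G v a) v)"
proof (rule bij_betw_same_card[where f = "\<lambda>H. contract H v a"])
  show "bij_betw (\<lambda>H. contract H v a) {H \<in> conn_subgraphs G. {v, a} \<in> edges H}
    (rooted (contract G v a) v)"
    by (rule bij_betw_byWitness[where f' = expand])
      (auto simp: contract_expand expand_contract expand_conn_subgraph contract_conn_subgraph,
        simp add: expand_def)
qed

lemma core_index_contract:
  "core_index G = core_index (contract G v a) + card (meeting (delete_edge G {v, a}) {v, a})"
proof -
  let ?K = "delete_edge G {v, a}" and ?P = "{H \<in> conn_subgraphs G. {v, a} \<in> edges H}"
  have K: "conn_subgraphs ?K = {H \<in> conn_subgraphs G. {v, a} \<notin> edges H}"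
    by (auto simp: conn_subgraphs_def subgraph_def)
  have "v \<in> verts H" if "H \<in> ?P" for H using that by (auto simp: conn_subgraphs_def subgraph_def)
  then have "meeting G {v, a} = ?P \<union> meeting ?K {v, a}" "?P \<inter> meeting ?K {v, a} = {}"
    by (auto simp: meeting_def K)
  then have "card (meeting G {v, a}) = card (rooted (contract G v a) v) + card (meeting ?K {v, a})"
    using finite_meeting[OF simple, of "{v, a}"]
    by (simp add: card_Un_disjoint flip: card_conn_subgraphs_edge)
  moreover have "delete_vertex (contract G v a) v = induced G (verts G - {v, a})"
  proof -
    have "{e \<in> edges (contract G v a). e \<subseteq> verts G - {v, a}} = {e \<in> edges G. e \<subseteq> verts G - {v, a}}"
      unfolding edges_contract by (auto simp: merge_image image_iff split: if_splits)
    then show ?thesis by (auto simp: delete_vertex_def induced_def)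
  qed
  ultimately show ?thesis
    using core_index_delete[OF simple, of "{v, a}"]
      core_index_delete_vertex[OF simple_contract, of v]
    by simp
qed

end

section \<open>Connected graphs in which every edge lies in a triangle\<close>

definition dense_vertex_sets :: "'a ugraph \<Rightarrow> 'a set set" where
  "dense_vertex_sets G
    = {S. S \<subseteq> verts G \<and> S \<noteq> {} \<and> 3 * card S \<le> 2 * card (edges (induced G S)) + 3}"

lemma dense_vertex_set_grows:
  assumes G: "connected_graph G" "simple_graph G"
    and tri: "\<And>u w. {u, w} \<in> edges G \<Longrightarrow> in_triangle G u w"
    and S: "S \<in> dense_vertex_sets G" "S \<noteq> verts G"
  obtains T where "T \<in> dense_vertex_sets G" "S \<subset> T"
proof -
  have sub: "S \<subseteq> verts G" "S \<noteq> {}" using S(1) by (simp_all add: dense_vertex_sets_def)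
  then have fin: "finite S" "finite (edges G)"
    using simple_graph_finite[OF G(2)] by (auto intro: finite_subset)
  obtain p q where "p \<in> verts G" "q \<in> verts G" "p \<in> S" "q \<notin> S" using S(2) sub by blast
  then obtain u w where uw: "{u, w} \<in> edges G" "u \<in> S" "w \<notin> S"
    using connected_graph_crossing_edge[OF G(1)] by metis
  obtain c where uc: "{u, c} \<in> edges G" and wc: "{w, c} \<in> edges G"
    using tri[OF uw(1)] by (auto simp: in_triangle_def)
  have V: "w \<in> verts G" "c \<in> verts G" and distinct: "c \<noteq> u" "c \<noteq> w" "u \<noteq> w"
    using simple_graph_edge_ends[OF G(2)] uw(1) uc wc by blast+
  let ?T = "insert c (insert w S)" and ?I = "edges (induced G S)"
  let ?new = "{{u, w}, {w, c}} \<union> (if c \<in> S then {} else {{u, c}})"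
  define k :: nat where "k = of_bool (c \<notin> S)"
  have "card ?new = 2 + k"
    using distinct uw(2,3) by (auto simp: doubleton_eq_iff k_def)
  moreover have "?new \<inter> ?I = {}" using uw(3) by auto
  then have "card (?new \<union> ?I) = card ?new + card ?I" using fin by (intro card_Un_disjoint) auto
  moreover have "?new \<union> ?I \<subseteq> edges (induced G ?T)" using uw uc wc by auto
  then have "card (?new \<union> ?I) \<le> card (edges (induced G ?T))" using fin by (intro card_mono) auto
  moreover have "card ?T = card S + 1 + k"
    using fin uw(3) distinct(2) by (simp add: insert_absorb k_def)
  moreover have "k \<le> 1" by (simp add: k_def)
  moreover have "3 * card S \<le> 2 * card ?I + 3" using S(1) by (simp add: dense_vertex_sets_def)
  ultimately have "3 * card ?T \<le> 2 * card (edges (induced G ?T)) + 3" by linarith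
  then have "?T \<in> dense_vertex_sets G" unfolding dense_vertex_sets_def using sub V by simp
  moreover have "S \<subset> ?T" using uw(3) by auto
  ultimately show ?thesis by (rule that)
qed

lemma size_ge_if_edges_in_triangles:
  assumes G: "connected_graph G" "simple_graph G"
    and tri: "\<And>u w. {u, w} \<in> edges G \<Longrightarrow> in_triangle G u w"
  shows "3 * card (verts G) \<le> 2 * card (edges G) + 3"
proof -
  obtain r where "r \<in> verts G" using connected_graph_nonempty[OF G(1)] by blast
  then have "{r} \<in> dense_vertex_sets G" by (simp add: dense_vertex_sets_def)
  moreover have "finite (dense_vertex_sets G)"
    using simple_graph_finite(1)[OF G(2)] by (simp add: dense_vertex_sets_def)
  ultimately obtain S where S: "S \<in> dense_vertex_sets G"
    and max: "\<And>T. T \<in> dense_vertex_sets G \<Longrightarrow> S \<subseteq> T \<Longrightarrow> T = S"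
    using finite_has_maximal[of "dense_vertex_sets G"] by (metis empty_iff)
  have "S = verts G"
  proof (rule ccontr)
    assume "S \<noteq> verts G"
    then obtain T where "T \<in> dense_vertex_sets G" "S \<subset> T"
      using dense_vertex_set_grows[OF G tri S] by blast
    then show False using max[of T] by auto
  qed
  moreover have "edges (induced G (verts G)) = edges G" using G(2) by (auto simp: simple_graph_def)
  ultimately show ?thesis using S by (simp add: dense_vertex_sets_def)
qed

section \<open>Bridges in graphs of minimum degree two\<close>

lemma bridge_sides:
  assumes G: "connected_graph G" "simple_graph G" and va: "{v, a} \<in> edges G"
    and disconnected: "\<not> connected_graph (delete_edge G {v, a})"
  defines "K \<equiv> delete_edge G {v, a}"
  shows "component K v \<inter> component K a = {}" "component K v \<union> component K a = verts G"
proof -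
  have ends: "v \<in> verts G" "a \<in> verts G" using simple_graph_edge_ends[OF G(2) va] by simp_all
  have "(v, a) \<notin> (adj K)\<^sup>*"
    using disconnected connected_delete_edge[OF G(1)] unfolding K_def by blast
  then show "component K v \<inter> component K a = {}"
    using adj_rtrancl_sym[of a _ K] rtrancl_trans[of v _ "adj K" a] by (auto simp: component_def)
  have sub: "component K v \<union> component K a \<subseteq> verts G"
    using component_subset[of K] simple_graph_delete_edge[OF G(2)] ends by (simp add: K_def)
  show "component K v \<union> component K a = verts G"
  proof (rule ccontr)
    assume "component K v \<union> component K a \<noteq> verts G"
    then obtain z where z: "z \<in> verts G" "z \<notin> component K v \<union> component K a" using sub by blast
    obtain p q where pq: "{p, q} \<in> edges G" "p \<in> component K v \<union> component K a"
      "q \<notin> component K v \<union> component K a"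
      by (rule connected_graph_crossing_edge[OF G(1) ends(1) z(1) _ z(2)])
        (simp add: component_self)
    then have "{p, q} \<noteq> {v, a}" by (auto simp: doubleton_eq_iff component_self)
    then have "{p, q} \<in> edges K" using pq(1) by (simp add: K_def)
    then show False using pq(2,3) component_closed[of p K v q] component_closed[of p K a q] by blast
  qed
qed

lemma bridge_decomposition:
  assumes G: "connected_graph G" "simple_graph G" and va: "{v, a} \<in> edges G"
    and disconnected: "\<not> connected_graph (delete_edge G {v, a})"
  defines "K \<equiv> delete_edge G {v, a}"
  defines "A \<equiv> induced K (component K v)" and "B \<equiv> induced K (component K a)"
  shows "bridge A B v a" "G = bridge_join v a A B"
proof -
  note sides = bridge_sides[OF G va disconnected, folded K_def]
  have K: "simple_graph K" unfolding K_def by (rule simple_graph_delete_edge[OF G(2)])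
  show "bridge A B v a"
  proof
    show "simple_graph A" "simple_graph B"
      using sides(2) simple_graph_induced[OF K] by (auto simp: A_def B_def K_def)
  qed (use sides(1) in \<open>simp_all add: A_def B_def component_self\<close>)
  have "e \<subseteq> component K v \<or> e \<subseteq> component K a" if e: "e \<in> edges K" for e
  proof -
    obtain x y where "e = {x, y}" "x \<in> verts K" using simple_graph_edgeE[OF K e] by metis
    then show ?thesis using component_edge[OF K e, of x] sides(2) by (auto simp: K_def)
  qed
  then have "edges K = edges A \<union> edges B" by (auto simp: A_def B_def)
  moreover have "edges G = insert {v, a} (edges K)" using va by (auto simp: K_def)
  ultimately show "G = bridge_join v a A B"
    using sides(2) by (simp add: prod_eq_iff A_def B_def)
qed

lemma degree_induced_component:
  assumes "simple_graph G" "x \<in> component G v"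
  shows "degree (induced G (component G v)) x = degree G x"
proof -
  have "{e \<in> edges (induced G (component G v)). x \<in> e} = {e \<in> edges G. x \<in> e}"
    using component_edge[OF assms(1) _ _ assms(2)] by auto
  then show ?thesis by (simp add: degree_def)
qed

lemma bridge_side_order_le_size:
  assumes G: "simple_graph G" and va: "{v, a} \<in> edges G"
    and deg: "\<And>x. x \<in> verts G \<Longrightarrow> 2 \<le> degree G x"
  defines "K \<equiv> delete_edge G {v, a}"
  assumes a: "a \<notin> component K v"
  shows "card (component K v) \<le> card (edges (induced K (component K v)))"
proof -
  let ?A = "induced K (component K v)"
  have K: "simple_graph K" unfolding K_def by (rule simple_graph_delete_edge[OF G])
  have ends: "v \<noteq> a" "v \<in> verts G" using simple_graph_edge_ends[OF G va] by simp_all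
  have sub: "component K v \<subseteq> verts K" using component_subset[OF K] ends(2) by (simp add: K_def)
  have degree_side: "degree G x = degree ?A x + of_bool (x = v)" if x: "x \<in> component K v" for x
    using degree_delete_edge[OF G va, of x] degree_induced_component[OF K x] x a
    by (auto simp: K_def)
  have "card (verts ?A) \<le> card (edges ?A)"
  proof (rule order_le_size)
    show "simple_graph ?A" by (rule simple_graph_induced[OF K sub])
    show "v \<in> verts ?A" by (simp add: component_self)
    show "1 \<le> degree ?A v" using degree_side[of v] deg[OF ends(2)] component_self[of v K] by simp
    fix x assume "x \<in> verts ?A" "x \<noteq> v"
    then show "2 \<le> degree ?A x" using degree_side[of x] deg[of x] sub by (auto simp: K_def)
  qed
  then show ?thesis by simp
qed

lemma bridge_decomposition_min_degree_2:
  assumes G: "connected_graph G" "simple_graph G" and va: "{v, a} \<in> edges G"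
    and deg: "\<And>x. x \<in> verts G \<Longrightarrow> 2 \<le> degree G x"
    and disconnected: "\<not> connected_graph (delete_edge G {v, a})"
  obtains A B where "bridge A B v a" "G = bridge_join v a A B"
    "connected_graph A" "card (verts A) \<le> card (edges A)"
    "connected_graph B" "card (verts B) \<le> card (edges B)"
proof -
  let ?K = "delete_edge G {v, a}"
  let ?A = "induced ?K (component ?K v)" and ?B = "induced ?K (component ?K a)"
  note join = bridge_decomposition[OF G va disconnected]
  have av: "{a, v} \<in> edges G" "delete_edge G {a, v} = ?K" using va by (simp_all add: insert_commute)
  have "a \<notin> component ?K v" "v \<notin> component ?K a"
    using bridge_sides(1)[OF G va disconnected] component_self[of v ?K] component_self[of a ?K]
    by blast+
  then have sides: "card (verts ?A) \<le> card (edges ?A)" "card (verts ?B) \<le> card (edges ?B)"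
    using bridge_side_order_le_size[OF G(2) va deg] bridge_side_order_le_size[OF G(2) av(1) deg]
    unfolding av(2) verts_induced by blast+
  show ?thesis
    by (rule that[OF join connected_induced_component sides(1)
          connected_induced_component sides(2)])
qed

section \<open>Edge sets and small graphs\<close>

lemma connected_subgraph_without_edges:
  assumes "connected_graph (W, {})"
  obtains v where "W = {v}"
proof -
  obtain v where v: "v \<in> W" using connected_graph_nonempty[OF assms] by auto
  have "x = v" if "x \<in> W" for x
    using connected_graph_crossing_edge[OF assms, of x v "{x}"] that v by auto
  then show ?thesis using that v by blast
qed

lemma connected_subgraph_verts:
  assumes "connected_graph (W, D)" "D \<noteq> {}" "\<forall>e\<in>D. e \<subseteq> W \<and> card e = 2"
  shows "W = \<Union>D"
proof
  show "\<Union>D \<subseteq> W" using assms(3) by blast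
  show "W \<subseteq> \<Union>D"
  proof
    fix x assume x: "x \<in> W"
    obtain e where e: "e \<in> D" using assms(2) by blast
    show "x \<in> \<Union>D"
    proof (cases "x \<in> e")
      case False
      then obtain y where "y \<in> e" "y \<in> W" "y \<notin> {x}" using e assms(3) by (fastforce simp: card_2_iff)
      obtain u w where "{u, w} \<in> D" "u \<in> {x}"
        by (rule connected_graph_crossing_edge[OF assms(1), of x y "{x}"])
          (use x \<open>y \<in> W\<close> \<open>y \<notin> {x}\<close> in simp_all)
      then show ?thesis by blast
    qed (use e in blast)
  qed
qed

definition connected_edge_sets :: "'a set set \<Rightarrow> 'a set set set" where
  "connected_edge_sets E = {D. D \<subseteq> E \<and> D \<noteq> {} \<and> connected_graph (\<Union>D, D)}"

lemma conn_subgraphs_eq_edge_sets: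
  assumes G: "simple_graph G"
  shows "conn_subgraphs G
    = (\<lambda>v. ({v}, {})) ` verts G \<union> (\<lambda>D. (\<Union>D, D)) ` connected_edge_sets (edges G)"
proof (intro set_eqI iffI)
  fix H assume H: "H \<in> conn_subgraphs G"
  obtain W D where WD: "H = (W, D)" by (cases H)
  have sub: "W \<subseteq> verts G" "D \<subseteq> edges G" "\<forall>e\<in>D. e \<subseteq> W" "connected_graph (W, D)"
    using H by (auto simp: WD conn_subgraphs_def subgraph_def)
  show "H \<in> (\<lambda>v. ({v}, {})) ` verts G \<union> (\<lambda>D. (\<Union>D, D)) ` connected_edge_sets (edges G)"
  proof (cases "D = {}")
    case True
    then obtain v where "W = {v}" using connected_subgraph_without_edges sub(4) by blast
    then show ?thesis using True sub(1) by (simp add: WD)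
  next
    case False
    then have "W = \<Union>D"
      using sub G by (intro connected_subgraph_verts) (auto simp: simple_graph_def)
    then show ?thesis using False sub(2,4) by (simp add: WD connected_edge_sets_def)
  qed
next
  fix H assume "H \<in> (\<lambda>v. ({v}, {})) ` verts G \<union> (\<lambda>D. (\<Union>D, D)) ` connected_edge_sets (edges G)"
  then consider (single) v where "v \<in> verts G" "H = ({v}, {})"
    | (edge_set) D where "D \<in> connected_edge_sets (edges G)" "H = (\<Union>D, D)" by blast
  then show "H \<in> conn_subgraphs G"
  proof cases
    case (edge_set D)
    moreover from edge_set have "\<Union>D \<subseteq> verts G"
      using G unfolding connected_edge_sets_def simple_graph_def by blast
    ultimately show ?thesis
      by (simp add: conn_subgraphs_def subgraph_def connected_edge_sets_def Union_upper)
  qed (simp add: conn_subgraphs_def subgraph_def connected_graph_singleton)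
qed

lemma core_index_eq_edge_sets:
  assumes G: "simple_graph G"
  shows "core_index G = card (verts G) + card (connected_edge_sets (edges G))"
proof -
  let ?single = "(\<lambda>v. ({v}, {})) :: 'a \<Rightarrow> 'a ugraph" and ?span = "\<lambda>D. (\<Union>D, D)"
  have "finite (connected_edge_sets (edges G))"
    using simple_graph_finite(2)[OF G] by (simp add: connected_edge_sets_def)
  moreover have "?single ` verts G \<inter> ?span ` connected_edge_sets (edges G) = {}"
    by (auto simp: connected_edge_sets_def)
  moreover have "inj_on ?single (verts G)" "inj_on ?span (connected_edge_sets (edges G))"
    by (auto simp: inj_on_def)
  ultimately show ?thesis
    using simple_graph_finite(1)[OF G]
    by (simp add: core_index_eq conn_subgraphs_eq_edge_sets[OF G] card_Un_disjoint card_image)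
qed

definition disconnected_edge_sets :: "'a set set \<Rightarrow> 'a set set set" where
  "disconnected_edge_sets E = {D. D \<subseteq> E \<and> D \<noteq> {} \<and> \<not> connected_graph (\<Union>D, D)}"

definition disjoint_edges :: "'a ugraph \<Rightarrow> 'a set \<Rightarrow> 'a set set" where
  "disjoint_edges G e = {f \<in> edges G. e \<inter> f = {}}"

definition disjoint_edge_pairs :: "'a ugraph \<Rightarrow> 'a set set set" where
  "disjoint_edge_pairs G = {{e, f} |e f. e \<in> edges G \<and> f \<in> disjoint_edges G e}"

lemma disconnected_edge_set_side:
  assumes G: "simple_graph G" and n: "card (verts G) \<le> 5"
    and disconnected: "D \<in> disconnected_edge_sets (edges G)"
  obtains S where "S \<noteq> {}" "S \<subset> \<Union>D" "card S \<le> 2" "\<forall>d\<in>D. d \<subseteq> S \<or> d \<inter> S = {}"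
proof -
  let ?H = "(\<Union>D, D)"
  have D: "D \<subseteq> edges G" "D \<noteq> {}" "\<not> connected_graph (\<Union>D, D)"
    using disconnected by (simp_all add: disconnected_edge_sets_def)
  have edge: "d \<subseteq> verts G \<and> card d = 2" if "d \<in> D" for d
    using that D(1) G by (auto simp: simple_graph_def)
  then have sub: "\<Union>D \<subseteq> verts G" by blast
  then have H: "simple_graph ?H"
    using simple_graph_finite(1)[OF G] edge by (auto simp: simple_graph_def intro: finite_subset)
  obtain d where d: "d \<in> D" using D(2) by blast
  then have "d \<noteq> {}" using edge by fastforce
  then obtain r where r: "r \<in> \<Union>D" using d by blast
  let ?C = "component ?H r"
  have C: "?C \<subseteq> \<Union>D" using component_subset[OF H, of r] r by simp
  have "{d \<in> D. d \<subseteq> \<Union>D} = D" by blast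
  then have "?C \<noteq> \<Union>D"
    using connected_induced_component[of ?H r] D(3) by (auto simp: induced_def)
  then have sides: "?C \<noteq> {}" "\<Union>D - ?C \<noteq> {}" using component_self[of r ?H] C by auto
  have closed: "d \<subseteq> ?C \<or> d \<subseteq> \<Union>D - ?C" if "d \<in> D" for d
    using component_edge[OF H, of d _ r] that by auto
  have fin: "finite (\<Union>D)" using simple_graph_finite(1)[OF H] by simp
  have "card ?C + card (\<Union>D - ?C) = card (\<Union>D)"
    using C fin by (metis card_Diff_subset card_mono finite_subset le_add_diff_inverse)
  also have "\<dots> \<le> 5"
    using card_mono[OF simple_graph_finite(1)[OF G] sub] n by simp
  finally have "card ?C \<le> 2 \<or> card (\<Union>D - ?C) \<le> 2" by linarith
  then show ?thesis
  proof
    assume "card ?C \<le> 2"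
    then show ?thesis using that[of ?C] sides C closed by blast
  next
    assume "card (\<Union>D - ?C) \<le> 2"
    then show ?thesis using that[of "\<Union>D - ?C"] sides C closed by blast
  qed
qed

text \<open>One side of a disconnected set of edges on five vertices has only two vertices.\<close>

lemma disconnected_edge_set:
  assumes G: "simple_graph G" and n: "card (verts G) \<le> 5"
    and disconnected: "D \<in> disconnected_edge_sets (edges G)"
  obtains e where "e \<in> D" "D - {e} \<subseteq> disjoint_edges G e" "D \<noteq> {e}"
proof -
  obtain S where S: "S \<noteq> {}" "S \<subset> \<Union>D" "card S \<le> 2"
    and closed: "\<forall>d\<in>D. d \<subseteq> S \<or> d \<inter> S = {}"
    using disconnected_edge_set_side[OF G n disconnected] .
  have D: "D \<subseteq> edges G" using disconnected by (simp add: disconnected_edge_sets_def)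
  obtain e f where ef: "e \<in> D" "e \<inter> S \<noteq> {}" "f \<in> D" "\<not> f \<subseteq> S" using S(1,2) by blast
  have edge: "finite d \<and> card d = 2" if "d \<in> D" for d
    using that D G by (auto simp: simple_graph_def card_ge_0_finite)
  have "finite S"
    using S(2) D G by (intro finite_subset[of S "verts G"]) (auto simp: simple_graph_def)
  moreover have "e \<subseteq> S" using closed ef(1,2) by blast
  ultimately have "e = S" using S(3) edge[OF ef(1)] by (metis card_seteq)
  have "d = e \<or> e \<inter> d = {}" if d: "d \<in> D" for d
  proof -
    have "d = e" if "d \<subseteq> e" using that edge[OF ef(1)] edge[OF d] by (simp add: card_subset_eq)
    then show ?thesis using closed d \<open>e = S\<close> by blast
  qed
  then have "D - {e} \<subseteq> disjoint_edges G e" using D by (auto simp: disjoint_edges_def)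
  then show ?thesis using that ef \<open>e = S\<close> by blast
qed

lemma card_subsets_ge_2:
  assumes "finite A"
  shows "card {T. T \<subseteq> A \<and> 2 \<le> card T} = 2 ^ card A - (card A + 1)"
proof -
  have "{T. T \<subseteq> A \<and> 2 \<le> card T} = Pow A - insert {} ((\<lambda>x. {x}) ` A)"
  proof (intro set_eqI iffI)
    fix T assume T: "T \<in> Pow A - insert {} ((\<lambda>x. {x}) ` A)"
    then have "finite T" using assms by (auto intro: finite_subset)
    moreover have "card T \<noteq> 1" using T by (auto simp: card_1_singleton_iff)
    ultimately show "T \<in> {T. T \<subseteq> A \<and> 2 \<le> card T}"
      using T by (cases "card T") auto
  qed auto
  moreover have "card (insert {} ((\<lambda>x. {x}) ` A)) = card A + 1"
    using assms by (simp add: card_image image_iff)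
  moreover have "insert {} ((\<lambda>x. {x}) ` A) \<subseteq> Pow A" by auto
  ultimately show ?thesis using assms by (simp add: card_Diff_subset card_Pow)
qed

lemma card_disjoint_edge_pairs:
  assumes G: "simple_graph G"
  shows "2 * card (disjoint_edge_pairs G) = (\<Sum>e\<in>edges G. card (disjoint_edges G e))"
proof -
  let ?P = "(edges G, disjoint_edge_pairs G)"
  have "e \<noteq> f" if "e \<in> edges G" "f \<in> disjoint_edges G e" for e f
    using that G by (auto simp: disjoint_edges_def simple_graph_def)
  then have P: "simple_graph ?P"
    using simple_graph_finite(2)[OF G]
    by (auto simp: simple_graph_def disjoint_edge_pairs_def disjoint_edges_def)
  have "degree ?P e = card (disjoint_edges G e)" if e: "e \<in> edges G" for e
  proof -
    have "{p \<in> disjoint_edge_pairs G. e \<in> p} = (\<lambda>f. {e, f}) ` disjoint_edges G e"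
      using e by (auto simp: disjoint_edge_pairs_def disjoint_edges_def)
    moreover have "inj_on (\<lambda>f. {e, f}) (disjoint_edges G e)"
      by (auto simp: inj_on_def doubleton_eq_iff)
    ultimately show ?thesis by (simp add: degree_def card_image)
  qed
  then show ?thesis using handshake[OF P] by simp
qed

lemma disconnected_edge_sets_cover:
  assumes G: "simple_graph G" and n: "card (verts G) \<le> 5"
  shows "disconnected_edge_sets (edges G) \<subseteq> disjoint_edge_pairs G
    \<union> (\<Union>e\<in>edges G. insert e ` {T. T \<subseteq> disjoint_edges G e \<and> 2 \<le> card T})" (is "_ \<subseteq> ?cover")
proof
  fix D assume D: "D \<in> disconnected_edge_sets (edges G)"
  then have sub: "D \<subseteq> edges G" by (simp add: disconnected_edge_sets_def)
  obtain e where e: "e \<in> D" "D - {e} \<subseteq> disjoint_edges G e" "D \<noteq> {e}"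
    using disconnected_edge_set[OF G n D] .
  have split: "e \<in> edges G" "D = insert e (D - {e})" "D - {e} \<noteq> {}" using e(1,3) sub by auto
  moreover have "finite (D - {e})"
    using sub simple_graph_finite(2)[OF G] by (auto intro: finite_subset)
  ultimately have "card (D - {e}) \<noteq> 0" by simp
  then consider (pair) "card (D - {e}) = 1" | (big) "2 \<le> card (D - {e})" by linarith
  then show "D \<in> ?cover"
  proof cases
    case pair
    then obtain f where "D - {e} = {f}" by (rule card_1_singletonE)
    then have "D = {e, f} \<and> f \<in> disjoint_edges G e" using split(2) e(2) by auto
    then show ?thesis using split(1) by (auto simp: disjoint_edge_pairs_def)
  next
    case big
    then have "D \<in> insert e ` {T. T \<subseteq> disjoint_edges G e \<and> 2 \<le> card T}"
      using split(2) e(2) by blast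
    then show ?thesis using split(1) by blast
  qed
qed

text \<open>
  A disconnected set of three or more edges determines its isolated edge, whereas both edges of a
  disjoint pair are isolated; hence the pairs are counted separately.
\<close>

definition disjointness_weight :: "'a ugraph \<Rightarrow> 'a set \<Rightarrow> nat" where
  "disjointness_weight G e = 2 * 2 ^ card (disjoint_edges G e) - (card (disjoint_edges G e) + 2)"

lemma card_disconnected_edge_sets:
  assumes G: "simple_graph G" and n: "card (verts G) \<le> 5"
  shows "2 * card (disconnected_edge_sets (edges G)) \<le> (\<Sum>e\<in>edges G. disjointness_weight G e)"
proof -
  let ?t = "\<lambda>e. card (disjoint_edges G e)"
  let ?big = "\<lambda>e. {T. T \<subseteq> disjoint_edges G e \<and> 2 \<le> card T}"
  have fin: "finite (edges G)" "finite (disjoint_edges G e)" for e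
    using simple_graph_finite(2)[OF G] by (simp_all add: disjoint_edges_def)
  have "disjoint_edge_pairs G \<subseteq> Pow (edges G)"
    by (auto simp: disjoint_edge_pairs_def disjoint_edges_def)
  then have "finite (disjoint_edge_pairs G)" using fin(1) by (simp add: finite_subset)
  then have "card (disconnected_edge_sets (edges G))
      \<le> card (disjoint_edge_pairs G \<union> (\<Union>e\<in>edges G. insert e ` ?big e))"
    using fin by (intro card_mono disconnected_edge_sets_cover[OF G n]) auto
  also have "\<dots> \<le> card (disjoint_edge_pairs G) + (\<Sum>e\<in>edges G. card (insert e ` ?big e))"
    using card_UN_le[OF fin(1)] by (intro card_Un_le[THEN order_trans] add_left_mono)
  also have "\<dots> \<le> card (disjoint_edge_pairs G) + (\<Sum>e\<in>edges G. 2 ^ ?t e - (?t e + 1))"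
    using fin(2) unfolding card_subsets_ge_2[OF fin(2), symmetric]
    by (intro add_left_mono sum_mono card_image_le) simp
  finally have "2 * card (disconnected_edge_sets (edges G))
      \<le> (\<Sum>e\<in>edges G. ?t e) + (\<Sum>e\<in>edges G. 2 * (2 ^ ?t e - (?t e + 1)))"
    using card_disjoint_edge_pairs[OF G] by (simp add: sum_distrib_left[symmetric])
  also have "\<dots> = (\<Sum>e\<in>edges G. disjointness_weight G e)"
  proof -
    have "k + 2 * (2 ^ k - (k + 1)) = 2 * 2 ^ k - (k + 2)" for k :: nat
      using less_exp[of k] by arith
    then show ?thesis by (simp only: sum.distrib[symmetric] disjointness_weight_def)
  qed
  finally show ?thesis .
qed

lemma core_index_order_le_5_ge:
  assumes G: "simple_graph G" and n: "card (verts G) \<le> 5"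
  shows "2 * (card (verts G) + 2 ^ card (edges G))
    \<le> 2 * core_index G + 2 + (\<Sum>e\<in>edges G. disjointness_weight G e)"
proof -
  let ?C = "connected_edge_sets (edges G)" and ?D = "disconnected_edge_sets (edges G)"
  have "Pow (edges G) = insert {} (?C \<union> ?D)"
    by (auto simp: connected_edge_sets_def disconnected_edge_sets_def)
  then have "card (Pow (edges G)) \<le> Suc (card (?C \<union> ?D))"
    using card_insert_le_m1[of "Suc (card (?C \<union> ?D))" "?C \<union> ?D" "{}"] by simp
  also have "\<dots> \<le> Suc (card ?C + card ?D)" by (simp only: Suc_le_mono card_Un_le)
  finally show ?thesis
    using core_index_eq_edge_sets[OF G] card_disconnected_edge_sets[OF G n]
      simple_graph_finite(2)[OF G] by (simp add: card_Pow)
qed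

lemma core_index_triangle:
  assumes G: "simple_graph G" and n: "card (verts G) = 3" and m: "card (edges G) = 3"
  shows "core_index G = 10"
proof -
  have "e \<inter> f \<noteq> {}" if "e \<in> edges G" "f \<in> edges G" for e f
  proof
    assume "e \<inter> f = {}"
    moreover have V: "e \<union> f \<subseteq> verts G" "card e = 2" "card f = 2"
      using that G by (auto simp: simple_graph_def)
    ultimately have "card (e \<union> f) = 4" by (simp add: card_Un_disjoint card_ge_0_finite)
    then show False using card_mono[OF simple_graph_finite(1)[OF G] V(1)] n by simp
  qed
  then have no_disjoint: "disjoint_edges G e = {}" if "e \<in> edges G" for e
    using that by (auto simp: disjoint_edges_def)
  have "D \<notin> disconnected_edge_sets (edges G)" for D
  proof
    assume D: "D \<in> disconnected_edge_sets (edges G)"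
    have "card (verts G) \<le> 5" using n by simp
    from disconnected_edge_set[OF G this D]
    obtain e where "e \<in> D" "D - {e} \<subseteq> disjoint_edges G e" "D \<noteq> {e}" .
    moreover have "D \<subseteq> edges G" using D by (simp add: disconnected_edge_sets_def)
    ultimately show False using no_disjoint[of e] by blast
  qed
  then have "connected_edge_sets (edges G) = Pow (edges G) - {{}}"
    by (auto simp: connected_edge_sets_def disconnected_edge_sets_def)
  then have "card (connected_edge_sets (edges G)) = 7"
    using simple_graph_finite(2)[OF G] m by (simp add: card_Pow)
  then show ?thesis using core_index_eq_edge_sets[OF G] n by simp
qed

lemma card_edges_le_choose:
  assumes "simple_graph G"
  shows "card (edges G) \<le> card (verts G) choose 2"
proof -
  have fin: "finite (verts G)" using simple_graph_finite(1)[OF assms] .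
  have "card (edges G) \<le> card {e. e \<subseteq> verts G \<and> card e = 2}"
    using fin assms by (intro card_mono) (auto simp: simple_graph_def)
  then show ?thesis using n_subsets[OF fin, of 2] by simp
qed

lemma order_ge_3_if_order_le_size:
  assumes "simple_graph G" "verts G \<noteq> {}" "card (verts G) \<le> card (edges G)"
  shows "3 \<le> card (verts G)"
proof (rule ccontr)
  assume "\<not> ?thesis"
  moreover have "card (verts G) \<noteq> 0" using assms(1,2) by (simp add: simple_graph_finite(1))
  ultimately consider "card (verts G) = 1" | "card (verts G) = 2" by linarith
  then show False
    using card_edges_le_choose[OF assms(1)] assms(3) by cases (simp_all add: choose_two)
qed

lemma core_index_order_3_le:
  assumes G: "simple_graph G" and n: "card (verts G) = 3"
  shows "core_index G \<le> 10"
proof -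
  have fin: "finite (verts G)" "finite (edges G)" using simple_graph_finite[OF G] .
  have "card (edges G) \<le> 3" using card_edges_le_choose[OF G] n by (simp add: choose_two)
  then have "(2::nat) ^ card (edges G) \<le> 2 ^ 3" by (intro power_increasing) simp_all
  moreover have "card (connected_edge_sets (edges G)) \<le> card (Pow (edges G) - {{}})"
    using fin(2) by (intro card_mono) (auto simp: connected_edge_sets_def)
  ultimately show ?thesis
    using core_index_eq_edge_sets[OF G] fin(2) n by (simp add: card_Pow)
qed

lemma core_index_order_4_size_5:
  assumes G: "simple_graph G" and n: "card (verts G) = 4" and m: "card (edges G) = 5"
  shows "33 \<le> core_index G"
proof -
  have "disjointness_weight G e \<le> 1" if e: "e \<in> edges G" for e
  proof -
    have "e \<subseteq> verts G" "card e = 2" using e G by (auto simp: simple_graph_def)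
    then have rest: "finite (verts G - e)" "card (verts G - e) = 2"
      using n simple_graph_finite(1)[OF G] by (simp_all add: card_Diff_subset finite_subset)
    have "disjoint_edges G e \<subseteq> {verts G - e}"
    proof
      fix f assume "f \<in> disjoint_edges G e"
      then have "f \<subseteq> verts G - e" "card f = 2"
        using G by (auto simp: disjoint_edges_def simple_graph_def)
      then show "f \<in> {verts G - e}" using card_subset_eq[OF rest(1)] rest(2) by simp
    qed
    then have "card (disjoint_edges G e) \<le> 1" using card_mono[of "{verts G - e}"] by fastforce
    then have "card (disjoint_edges G e) = 0 \<or> card (disjoint_edges G e) = 1" by linarith
    then show ?thesis by (auto simp: disjointness_weight_def)
  qed
  then have "(\<Sum>e\<in>edges G. disjointness_weight G e) \<le> 5"
    using sum_bounded_above[of "edges G" "disjointness_weight G" 1] m by simp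
  then show ?thesis using core_index_order_le_5_ge[OF G] n m by simp
qed

lemma core_index_order_5_pendant:
  assumes G: "simple_graph G" and n: "card (verts G) = 5" and m: "card (edges G) = 6"
    and deg: "degree G v = 1"
  shows "57 \<le> core_index G"
proof -
  obtain x where x: "{e \<in> edges G. v \<in> e} = {{v, x}}" "x \<noteq> v" "x \<in> verts G"
    using degree_one_neighbour[OF G deg] .
  then have vx: "{v, x} \<in> edges G" by blast
  let ?H = "delete_vertex G v"
  have H: "simple_graph ?H" by (rule simple_graph_delete_vertex[OF G])
  have "Suc (card (verts ?H)) = card (verts G)"
    using simple_graph_edge_ends[OF G vx] by (intro card_verts_delete_vertex[OF G])
  then have card: "card (verts ?H) = 4" "card (edges ?H) = 5"
    using n m deg card_edges_delete_vertex[OF G, of v] by simp_all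
  have "Suc (card (verts (delete_vertex ?H x))) = card (verts ?H)"
    using x by (intro card_verts_delete_vertex[OF H]) simp
  then have "core_index (delete_vertex ?H x) \<le> 10"
    using core_index_order_3_le[OF simple_graph_delete_vertex[OF H]] card(1) by simp
  then show ?thesis
    using core_index_order_4_size_5[OF H card] core_index_delete_vertex[OF H, of x]
      core_index_delete_vertex[OF G, of v] card_rooted_degree_one[OF G deg vx] by linarith
qed

lemma card_disjoint_edges:
  assumes G: "simple_graph G" and xy: "{x, y} \<in> edges G"
  shows "card (disjoint_edges G {x, y}) + degree G x + degree G y = Suc (card (edges G))"
proof -
  let ?at = "\<lambda>x. {e \<in> edges G. x \<in> e}"
  have fin: "finite (edges G)" using simple_graph_finite(2)[OF G] .
  have "e = {x, y}" if "e \<in> edges G" "x \<in> e" "y \<in> e" for e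
    using simple_graph_edge_atE[OF G that(1,2)] that(3) simple_graph_edge_ends(1)[OF G xy] by blast
  then have "?at x \<inter> ?at y = {{x, y}}" using xy by blast
  then have "card (?at x \<union> ?at y) + 1 = degree G x + degree G y"
    using card_Un_Int[of "?at x" "?at y"] fin by (simp add: degree_def)
  moreover have "card (disjoint_edges G {x, y} \<union> (?at x \<union> ?at y))
      = card (disjoint_edges G {x, y}) + card (?at x \<union> ?at y)"
    using fin by (intro card_Un_disjoint) (auto simp: disjoint_edges_def)
  moreover have "disjoint_edges G {x, y} \<union> (?at x \<union> ?at y) = edges G"
    by (auto simp: disjoint_edges_def)
  ultimately show ?thesis by simp
qed

lemma degrees_of_bicyclic:
  assumes G: "simple_graph G" and m: "card (edges G) = Suc (card (verts G))"
    and deg: "\<And>x. x \<in> verts G \<Longrightarrow> 2 \<le> degree G x"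
  obtains u w where "u \<in> verts G" "w \<in> verts G"
    "\<And>x. x \<in> verts G \<Longrightarrow> degree G x = 2 + of_bool (x = u) + of_bool (x = w)"
proof -
  have fin: "finite (verts G)" using simple_graph_finite(1)[OF G] .
  have "(\<Sum>x\<in>verts G. degree G x - 2) + (\<Sum>x\<in>verts G. 2) = (\<Sum>x\<in>verts G. degree G x)"
    unfolding sum.distrib[symmetric] by (intro sum.cong refl le_add_diff_inverse2 deg)
  then have excess: "(\<Sum>x\<in>verts G. degree G x - 2) = 2" using handshake[OF G] m by simp
  then obtain u where u: "u \<in> verts G" "0 < degree G u - 2"
    by (metis (no_types, lifting) gr0I sum.neutral zero_neq_numeral)
  have "(\<Sum>x\<in>verts G. degree G x - 2 - of_bool (x = u)) + (\<Sum>x\<in>verts G. of_bool (x = u))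
      = (\<Sum>x\<in>verts G. degree G x - 2)"
    unfolding sum.distrib[symmetric] using u(2) by (intro sum.cong) auto
  then have "(\<Sum>x\<in>verts G. degree G x - 2 - of_bool (x = u)) = 1"
    using excess u(1) fin by (simp add: of_bool_def)
  then obtain w where w: "w \<in> verts G" "degree G w - 2 - of_bool (w = u) = 1"
    and rest: "\<forall>x\<in>verts G. w \<noteq> x \<longrightarrow> degree G x - 2 - of_bool (x = u) = 0"
    unfolding sum_eq_1_iff[OF fin] by blast
  have "degree G x = 2 + of_bool (x = u) + of_bool (x = w)" if x: "x \<in> verts G" for x
  proof (cases "x = w")
    case True
    then show ?thesis using w(2) deg[OF x] by (cases "x = u") simp_all
  next
    case False
    then show ?thesis using bspec[OF rest x] deg[OF x] u(2) by (cases "x = u") simp_all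
  qed
  then show ?thesis using that u(1) w(1) by blast
qed

lemma core_index_order_5_size_6_min_degree_2:
  assumes G: "simple_graph G" and n: "card (verts G) = 5" and m: "card (edges G) = 6"
    and deg: "\<And>x. x \<in> verts G \<Longrightarrow> 2 \<le> degree G x"
  shows "54 \<le> core_index G"
proof -
  let ?weight = "disjointness_weight G"
  have fin: "finite (edges G)" using simple_graph_finite(2)[OF G] .
  obtain u w where uw: "u \<in> verts G" "w \<in> verts G"
    and degree: "\<And>x. x \<in> verts G \<Longrightarrow> degree G x = 2 + of_bool (x = u) + of_bool (x = w)"
    by (rule degrees_of_bicyclic[OF G _ deg]) (use n m in auto)
  have "?weight e + 7 * of_bool (u \<in> e) + 7 * of_bool (w \<in> e)
      = 11 + 4 * of_bool (u \<in> e \<and> w \<in> e)"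
    if e: "e \<in> edges G" for e
  proof -
    obtain x y where xy: "e = {x, y}" "x \<noteq> y" "x \<in> verts G" "y \<in> verts G"
      using simple_graph_edgeE[OF G e] .
    have "card (disjoint_edges G e) + of_bool (u \<in> e) + of_bool (w \<in> e) = 3"
      using card_disjoint_edges[OF G, of x y] degree xy e m by auto
    \<comment> \<open>Hence e has weight 11, 4 or 1.\<close>
    then show ?thesis by (cases "u \<in> e"; cases "w \<in> e") (auto simp: disjointness_weight_def)
  qed
  then have "(\<Sum>e\<in>edges G. ?weight e + 7 * of_bool (u \<in> e) + 7 * of_bool (w \<in> e))
      = (\<Sum>e\<in>edges G. 11 + 4 * of_bool (u \<in> e \<and> w \<in> e))"
    by (rule sum.cong[OF refl])
  then have weights: "(\<Sum>e\<in>edges G. ?weight e) + 7 * degree G u + 7 * degree G w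
      = 66 + 4 * card {e \<in> edges G. u \<in> e \<and> w \<in> e}"
    using fin m by (simp add: sum.distrib sum_distrib_left[symmetric] degree_def Int_def)
  have "(\<Sum>e\<in>edges G. ?weight e) \<le> 28"
  proof (cases "u = w")
    case True
    then show ?thesis using weights degree[OF uw(1)] by (simp add: degree_def)
  next
    case False
    have "{e \<in> edges G. u \<in> e \<and> w \<in> e} \<subseteq> {{u, w}}"
      using False simple_graph_edge_atE[OF G] by blast
    then have "card {e \<in> edges G. u \<in> e \<and> w \<in> e} \<le> 1" using card_mono[of "{{u, w}}"] by fastforce
    then show ?thesis using weights degree[OF uw(1)] degree[OF uw(2)] False by simp
  qed
  then show ?thesis using core_index_order_le_5_ge[OF G] n m by simp
qed

lemma core_index_order_5_ge:
  assumes G: "connected_graph G" "simple_graph G"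
    and n: "card (verts G) = 5" and m: "6 \<le> card (edges G)"
  shows "54 \<le> core_index G"
proof -
  obtain T where T: "T \<in> spanning G" "Suc (card T) = card (verts G)"
    using spanning_tree_exists[OF G] .
  then obtain D where D: "T \<subseteq> D" "D \<subseteq> edges G" "card D = 6"
    using exists_subset_between[of T 6 "edges G"] simple_graph_finite(2)[OF G(2)] n m
    by (auto simp: spanning_def)
  let ?H = "(verts G, D)"
  have H: "simple_graph ?H" "connected_graph ?H" "subgraph ?H G"
    using simple_graph_edge_subset[OF G(2) D(2)] T(1) D(1,2) G(2)
      connected_graph_mono[of "(verts G, T)" ?H]
    by (auto simp: spanning_def subgraph_def simple_graph_def)
  have "54 \<le> core_index ?H"
  proof (cases "\<exists>v. degree ?H v = 1")
    case True
    then show ?thesis using core_index_order_5_pendant[OF H(1)] n D(3) by fastforce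
  next
    case False
    have "2 \<le> degree ?H x" if "x \<in> verts ?H" for x
    proof -
      have "1 \<le> degree ?H x" using that n by (intro degree_pos[OF H(2,1)]) simp_all
      then show ?thesis using False by (metis Suc_leI le_neq_implies_less one_add_one plus_1_eq_Suc)
    qed
    then show ?thesis using core_index_order_5_size_6_min_degree_2[OF H(1)] n D(3) by simp
  qed
  then show ?thesis using core_index_mono[OF G(2) H(3)] by linarith
qed

section \<open>Cycles\<close>

definition bridgeless :: "'a ugraph \<Rightarrow> bool" where
  "bridgeless G \<longleftrightarrow> (\<forall>e\<in>edges G. connected_graph (delete_edge G e))"

lemma bridgeless_if_size_le_order:
  assumes G: "connected_graph G" "simple_graph G" and m: "card (edges G) \<le> card (verts G)"
    and deg: "\<And>x. x \<in> verts G \<Longrightarrow> 2 \<le> degree G x"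
  shows "bridgeless G"
  unfolding bridgeless_def
proof
  fix e assume e: "e \<in> edges G"
  then obtain v a where va: "e = {v, a}" using simple_graph_edgeE[OF G(2)] by metis
  show "connected_graph (delete_edge G e)"
  proof (rule ccontr)
    assume "\<not> connected_graph (delete_edge G e)"
    then obtain A B where "bridge A B v a" and join: "G = bridge_join v a A B"
      and sides: "card (verts A) \<le> card (edges A)" "card (verts B) \<le> card (edges B)"
      using bridge_decomposition_min_degree_2[OF G _ deg] e unfolding va by metis
    then interpret bridge A B v a by blast
    show False using order_joined size_joined sides m unfolding join by linarith
  qed
qed

lemma bridgeless_degree_ge_2:
  assumes G: "simple_graph G" "bridgeless G" "connected_graph G"
    and v: "v \<in> verts G" "2 \<le> card (verts G)"
  shows "2 \<le> degree G v"
proof -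
  have "degree G v \<noteq> 1"
  proof
    assume deg: "degree G v = 1"
    obtain x where "{e \<in> edges G. v \<in> e} = {{v, x}}" using degree_one_neighbour[OF G(1) deg] .
    then have e: "{v, x} \<in> edges G" by blast
    then have "1 \<le> degree (delete_edge G {v, x}) v"
      using G(2) v simple_graph_delete_edge[OF G(1)]
      by (intro degree_pos) (auto simp: bridgeless_def)
    then show False using degree_delete_edge[OF G(1) e, of v] deg by simp
  qed
  then show ?thesis using degree_pos[OF G(3,1) v] by linarith
qed

lemma (in contraction) bridgeless_contract:
  assumes "bridgeless G"
  shows "bridgeless (contract G v a)"
  unfolding bridgeless_def
proof
  fix d assume "d \<in> edges (contract G v a)"
  then obtain e where e: "e \<in> edges G - {{v, a}}" "d = merge v a ` e"
    unfolding edges_contract by blast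
  have con: "connected_graph (contract (delete_edge G e) v a)"
    using assms e(1) ends by (intro connected_contract) (auto simp: bridgeless_def)
  have "edges (contract (delete_edge G e) v a) \<subseteq> edges (delete_edge (contract G v a) d)"
    using inj_on_merge_edges e by (auto simp: edges_contract dest: inj_onD)
  then show "connected_graph (delete_edge (contract G v a) d)"
    by (rule connected_graph_mono[OF con, rotated]) simp
qed

lemma degree_eq_2:
  assumes G: "simple_graph G" and m: "card (edges G) \<le> card (verts G)"
    and deg: "\<And>x. x \<in> verts G \<Longrightarrow> 2 \<le> degree G x" and v: "v \<in> verts G"
  shows "degree G v = 2"
proof (rule ccontr)
  assume "degree G v \<noteq> 2"
  then have "2 < degree G v" using deg[OF v] by simp
  then have "(\<Sum>x\<in>verts G. 2) < (\<Sum>x\<in>verts G. degree G x)"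
    using v deg by (intro sum_strict_mono_ex1[OF simple_graph_finite(1)[OF G]]) auto
  then show False using handshake[OF G] m by simp
qed

lemma simple_graph_order_1:
  assumes G: "simple_graph G" "card (verts G) = 1" and v: "v \<in> verts G"
  shows "G = ({v}, {})"
proof -
  have V: "verts G = {v}" using v G(2) by (metis card_1_singletonE singletonD)
  have "e \<notin> edges G" for e
  proof
    assume "e \<in> edges G"
    then obtain x y where "x \<noteq> y" "x \<in> verts G" "y \<in> verts G" by (rule simple_graph_edgeE[OF G(1)])
    then show False by (simp add: V)
  qed
  then have "edges G = {}" by blast
  then show ?thesis using V by (simp add: prod_eq_iff)
qed

lemma card_rooted_path_end:
  assumes "connected_graph G" "simple_graph G" "v \<in> verts G"
    and "\<And>x. x \<in> verts G \<Longrightarrow> degree G x \<le> 2" "degree G v \<le> 1"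
  shows "card (rooted G v) = card (verts G)"
  using assms
proof (induction "card (verts G)" arbitrary: G v)
  case 0
  then show ?case using simple_graph_finite(1)[of G] by auto
next
  case (Suc n)
  note G = Suc.prems(1,2) and v = Suc.prems(3)
  show ?case
  proof (cases n)
    case 0
    then have "G = ({v}, {})" using simple_graph_order_1[OF G(2) _ v] Suc.hyps(2) by simp
    then show ?thesis using card_rooted_singleton by auto
  next
    case (Suc k)
    then have deg: "degree G v = 1" using degree_pos[OF G v] Suc.prems(5) Suc.hyps(2) by linarith
    obtain x where x: "{e \<in> edges G. v \<in> e} = {{v, x}}" "x \<noteq> v" "x \<in> verts G"
      using degree_one_neighbour[OF G(2) deg] .
    then have vx: "{v, x} \<in> edges G" by blast
    let ?G = "delete_vertex G v"
    have card: "Suc (card (verts ?G)) = card (verts G)"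
      by (rule card_verts_delete_vertex[OF G(2) v])
    have "card (rooted ?G x) = card (verts ?G)"
    proof (rule Suc.hyps(1))
      show "connected_graph ?G" by (rule connected_delete_degree_one[OF G deg])
      show "degree ?G y \<le> 2" if "y \<in> verts ?G" for y
        using degree_mono[OF G(2) subgraph_delete_vertex, of v y] Suc.prems(4)[of y] that by simp
      show "degree ?G x \<le> 1" using degree_delete_neighbour[OF G(2) vx] Suc.prems(4)[OF x(3)] by simp
    qed (use Suc.hyps(2) card x simple_graph_delete_vertex[OF G(2)] in simp_all)
    then show ?thesis using card_rooted_degree_one[OF G(2) deg vx] card by simp
  qed
qed

lemma (in contraction) card_meeting_ends_of_cycle:
  assumes con: "connected_graph G" and bridgeless: "bridgeless G"
    and m: "card (edges G) \<le> card (verts G)"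
  shows "Suc (card (meeting (delete_edge G {v, a}) {v, a})) = 2 * card (verts G)"
proof -
  have "2 \<le> card (verts G)"
    using card_mono[OF simple_graph_finite(1)[OF simple], of "{v, a}"] ends by simp
  then have degG: "degree G x = 2" if "x \<in> verts G" for x
    using degree_eq_2[OF simple m] bridgeless_degree_ge_2[OF simple bridgeless con] that by blast
  define K where "K = delete_edge G {v, a}"
  define L where "L = delete_vertex K v"
  have K: "connected_graph K" "simple_graph K" "verts K = verts G"
    using bridgeless edge simple_graph_delete_edge[OF simple] by (auto simp: K_def bridgeless_def)
  have degK: "degree K x + of_bool (x \<in> {v, a}) = 2" if "x \<in> verts G" for x
    using degree_delete_edge[OF simple edge, of x] degG[OF that] by (simp add: K_def)
  have degKv: "degree K v = 1" using degK[OF ends(2)] by simp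
  have L: "connected_graph L" "simple_graph L" "verts L = verts G - {v}"
    using connected_delete_degree_one[OF K(1,2) degKv] simple_graph_delete_vertex[OF K(2)] K(3)
    by (simp_all add: L_def)
  have degL: "degree L x \<le> degree K x" for x
    unfolding L_def by (rule degree_mono[OF K(2) subgraph_delete_vertex])
  have "card (rooted K v) = card (verts K)"
  proof (rule card_rooted_path_end[OF K(1,2)])
    show "degree K x \<le> 2" if "x \<in> verts K" for x using degK[of x] that K(3) by simp
  qed (use K(3) ends(2) degKv in simp_all)
  moreover have "card (rooted L a) = card (verts L)"
  proof (rule card_rooted_path_end[OF L(1,2)])
    show "a \<in> verts L" using ends L(3) by simp
    show "degree L x \<le> 2" if "x \<in> verts L" for x using degL[of x] degK[of x] that L(3) by auto
    show "degree L a \<le> 1" using degL[of a] degK[OF ends(3)] by simp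
  qed
  moreover have "Suc (card (verts L)) = card (verts K)"
    unfolding L_def using ends(2) K by (intro card_verts_delete_vertex) simp_all
  ultimately show ?thesis
    using card_meeting_insert[OF K(2), of v "{a}"] K(3) by (simp add: K_def L_def)
qed

theorem core_index_bridgeless_unicyclic:
  assumes "connected_graph G" "simple_graph G" "bridgeless G"
    and "3 \<le> card (verts G)" "card (edges G) = card (verts G)"
  shows "core_index G = (card (verts G))\<^sup>2 + 1"
  using assms
proof (induction "card (verts G)" arbitrary: G)
  case 0
  then show ?case by simp
next
  case (Suc n)
  note G = Suc.prems(1,2)
  show ?case
  proof (cases "card (verts G) = 3")
    case True
    then show ?thesis using core_index_triangle[OF G(2)] Suc.prems(5) by simp
  next
    case False
    have "\<exists>v a. {v, a} \<in> edges G \<and> \<not> in_triangle G v a"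
    proof (rule ccontr)
      assume "\<not> ?thesis"
      then have "3 * card (verts G) \<le> 2 * card (edges G) + 3"
        using size_ge_if_edges_in_triangles[OF G] by blast
      then show False using False Suc.prems(4,5) by linarith
    qed
    then obtain v a where "{v, a} \<in> edges G" "\<not> in_triangle G v a" by blast
    then interpret contraction G v a using G(2) by unfold_locales
    have "core_index (contract G v a) = (card (verts (contract G v a)))\<^sup>2 + 1"
      using Suc.hyps Suc.prems False card_contract ends(1,2)
      by (intro Suc.hyps(1) connected_contract simple_contract bridgeless_contract) simp_all
    moreover have "card (verts (contract G v a)) = n" using card_contract(1) Suc.hyps(2) by simp
    moreover have "Suc (card (meeting (delete_edge G {v, a}) {v, a})) = 2 * Suc n"
      using card_meeting_ends_of_cycle[OF G(1) Suc.prems(3)] Suc.prems(5) Suc.hyps(2) by simp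
    ultimately show ?thesis
      using core_index_contract by (simp add: power2_eq_square Suc.hyps(2)[symmetric])
  qed
qed

corollary core_index_unicyclic_min_degree_2:
  assumes G: "connected_graph G" "simple_graph G" and n: "3 \<le> card (verts G)"
    and m: "card (edges G) \<le> card (verts G)"
    and deg: "\<And>x. x \<in> verts G \<Longrightarrow> 2 \<le> degree G x"
  shows "core_index G = (card (verts G))\<^sup>2 + 1"
proof -
  obtain v where v: "v \<in> verts G" using connected_graph_nonempty[OF G(1)] by blast
  have "1 \<le> degree G v" using deg[OF v] by simp
  then have "card (verts G) \<le> card (edges G)" using deg by (rule order_le_size[OF G(2) v])
  then show ?thesis
    using core_index_bridgeless_unicyclic[OF G bridgeless_if_size_le_order[OF G m deg] n] m by simp
qed

lemma connected_cycle_graph: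
  assumes "0 < n"
  shows "connected_graph (cycle_graph n)"
proof (rule connected_graph_from_root)
  show "0 \<in> verts (cycle_graph n)" using assms by (simp add: cycle_graph_def)
  fix k assume "k \<in> verts (cycle_graph n)"
  then have "k < n" by (simp add: cycle_graph_def)
  then show "(0, k) \<in> (adj (cycle_graph n))\<^sup>*"
  proof (induction k)
    case (Suc k)
    then have "{k, Suc k} \<in> edges (cycle_graph n)"
      by (auto simp: cycle_graph_def intro!: exI[of _ k])
    then show ?case using Suc by (auto simp: in_adj_iff intro: rtrancl_into_rtrancl)
  qed simp
qed

lemma degree_cycle_graph_ge_2:
  assumes n: "3 \<le> n" and i: "i < n"
  shows "2 \<le> degree (cycle_graph n) i"
proof -
  define j where "j = (if i = 0 then n - 1 else i - 1)"
  have j: "j < n" "(j + 1) mod n = i" using n i by (auto simp: j_def)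
  have "(i + 1) mod n \<noteq> j"
    using n i by (cases "i + 1 = n"; cases "i = 0") (simp_all add: j_def)
  then have "{i, (i + 1) mod n} \<noteq> {j, i}" by (auto simp: doubleton_eq_iff)
  then have "card {{i, (i + 1) mod n}, {j, i}} = 2" by simp
  moreover have "{{i, (i + 1) mod n}, {j, i}} \<subseteq> {e \<in> edges (cycle_graph n). i \<in> e}"
    using i j by (auto simp: cycle_graph_def)
  moreover have "finite {e \<in> edges (cycle_graph n). i \<in> e}" by (simp add: cycle_graph_def)
  ultimately show ?thesis unfolding degree_def by (metis card_mono)
qed

corollary core_index_cycle_graph:
  assumes n: "3 \<le> n"
  shows "core_index (cycle_graph n) = n\<^sup>2 + 1"
proof -
  have verts: "verts (cycle_graph n) = {..<n}" by (simp add: cycle_graph_def)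
  have edges: "edges (cycle_graph n) = (\<lambda>i. {i, (i + 1) mod n}) ` {..<n}"
    by (auto simp: cycle_graph_def)
  have "i \<noteq> (i + 1) mod n" if "i < n" for i using that n by (auto simp: mod_if)
  then have "simple_graph (cycle_graph n)"
    using n by (auto simp: simple_graph_def verts edges)
  moreover have "card (edges (cycle_graph n)) \<le> n"
    unfolding edges using card_image_le[of "{..<n}"] by simp
  ultimately show ?thesis
    using core_index_unicyclic_min_degree_2[OF connected_cycle_graph, of n]
      degree_cycle_graph_ge_2[OF n] n
    by (simp add: verts)
qed

section \<open>Graphs with more edges than vertices\<close>

definition bicyclic_bound :: "nat \<Rightarrow> nat" where
  "bicyclic_bound n = (if n = 5 then 54 else (n\<^sup>2 + 17 * n) div 2)"

lemma bicyclic_bound_le_add: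
  assumes n: "Suc k = n" "6 \<le> n"
    and bound: "bicyclic_bound k \<le> c" and gain: "n + 8 + of_bool (n = 6) \<le> d"
  shows "bicyclic_bound n \<le> c + d"
proof (cases "n = 6")
  case True
  then have "k = 5" using n(1) by simp
  then show ?thesis using bound gain True by (simp add: bicyclic_bound_def)
next
  case False
  have "n\<^sup>2 + 17 * n = k\<^sup>2 + 17 * k + (n + 8) * 2"
    unfolding n(1)[symmetric] by (simp add: power2_eq_square)
  then have "(n\<^sup>2 + 17 * n) div 2 = (k\<^sup>2 + 17 * k) div 2 + (n + 8)" by simp
  then show ?thesis using n bound gain False by (auto simp: bicyclic_bound_def split: if_splits)
qed

lemma components_of_edge_ends_cover:
  assumes G: "connected_graph (delete_edge G {v, a})" "simple_graph G" and va: "{v, a} \<in> edges G"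
  shows "card (verts G)
    < card (component (delete_vertex G v) a) + card (component (delete_vertex G a) v)"
proof -
  let ?A = "component (delete_vertex G v) a" and ?B = "component (delete_vertex G a) v"
  have ends: "v \<noteq> a" "v \<in> verts G" "a \<in> verts G" using simple_graph_edge_ends[OF G(2) va] .
  have sub: "?A \<subseteq> verts G - {v}" "?B \<subseteq> verts G - {a}"
    using component_subset[OF simple_graph_delete_vertex[OF G(2)]] ends by fastforce+
  have leave_A: "q = v" if "{p, q} \<in> edges G" "p \<in> ?A" "q \<notin> ?A" for p q
    using that sub(1) component_closed[of p "delete_vertex G v" a q]
    by (auto simp: edges_delete_vertex[OF G(2)])
  have leave_B: "q = a" if "{p, q} \<in> edges G" "p \<in> ?B" "q \<notin> ?B" for p q
    using that sub(2) component_closed[of p "delete_vertex G a" v q]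
    by (auto simp: edges_delete_vertex[OF G(2)])
  have "?A \<union> ?B = verts G"
  proof (rule ccontr)
    assume "?A \<union> ?B \<noteq> verts G"
    then obtain z where z: "z \<in> verts (delete_edge G {v, a})" "z \<notin> ?A \<union> ?B" using sub by auto
    obtain p q where pq: "{p, q} \<in> edges (delete_edge G {v, a})" "p \<in> ?A \<union> ?B" "q \<notin> ?A \<union> ?B"
      by (rule connected_graph_crossing_edge[OF G(1) _ z(1) _ z(2), of v])
        (simp_all add: ends component_self)
    then have "q = v \<or> q = a" using leave_A[of p q] leave_B[of p q] by auto
    then show False
      using pq(3) component_self[of a "delete_vertex G v"] component_self[of v "delete_vertex G a"]
      by blast
  qed
  moreover obtain p where p: "{v, p} \<in> edges G" "p \<in> ?A" "p \<noteq> a"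
  proof -
    have "v \<notin> ?A" using sub(1) by blast
    then obtain p q where pq: "{p, q} \<in> edges (delete_edge G {v, a})" "p \<in> ?A" "q \<notin> ?A"
      using connected_graph_crossing_edge[OF G(1), of a v ?A] ends component_self[of a] by auto
    moreover from this have "q = v" using leave_A[of p q] by simp
    ultimately show ?thesis using that[of p] by (auto simp: insert_commute)
  qed
  then have "p \<in> ?B" using leave_B[of v p] component_self[of v] by blast
  then have "?A \<inter> ?B \<noteq> {}" using p(2) by blast
  moreover have fin: "finite ?A" "finite ?B"
    using sub simple_graph_finite(1)[OF G(2)] by (auto intro: finite_subset)
  ultimately have "card (?A \<inter> ?B) \<noteq> 0" by simp
  then show ?thesis using card_Un_Int[OF fin] \<open>?A \<union> ?B = verts G\<close> by simp
qed

lemma order_of_component_delete_vertex: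
  assumes G: "simple_graph G" and va: "{v, a} \<in> edges G"
    and deg: "\<And>x. x \<in> verts G \<Longrightarrow> 2 \<le> degree G x"
  defines "A \<equiv> component (delete_vertex G v) a"
  shows "Suc (card A) = card (verts G) \<or> card A + 3 \<le> card (verts G)"
proof (cases "A = verts G - {v}")
  case True
  then show ?thesis
    using card_verts_delete_vertex[OF G] simple_graph_edge_ends(2)[OF G va] by simp
next
  case False
  have ends: "v \<noteq> a" "v \<in> verts G" "a \<in> verts G" using simple_graph_edge_ends[OF G va] .
  have sub: "A \<subseteq> verts G - {v}"
    using component_subset[OF simple_graph_delete_vertex[OF G], of a v] ends by (simp add: A_def)
  then obtain z where z: "z \<in> verts G" "z \<noteq> v" "z \<notin> A" using False by blast
  obtain y where y: "{z, y} \<in> edges G" "y \<noteq> v" using two_neighbours[OF G deg[OF z(1)]] by metis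
  have yz: "y \<noteq> z" "y \<in> verts G" using simple_graph_edge_ends[OF G y(1)] by simp_all
  have "{y, z} \<in> edges (delete_vertex G v)"
    using y z(2) by (simp add: edges_delete_vertex[OF G] insert_commute)
  then have "y \<notin> A" using component_closed[of y "delete_vertex G v" a z] z(3) by (auto simp: A_def)
  have fin: "finite A" using sub simple_graph_finite(1)[OF G] by (auto intro: finite_subset)
  have "card (insert v (insert y (insert z A))) \<le> card (verts G)"
    using sub y z yz ends simple_graph_finite(1)[OF G] by (intro card_mono) auto
  moreover have "v \<notin> A" using sub by blast
  ultimately show ?thesis using fin y(2) z yz(1) \<open>y \<notin> A\<close> by simp
qed

lemma card_meeting_ends_non_bridge:
  assumes G: "connected_graph (delete_edge G {v, a})" "simple_graph G" and va: "{v, a} \<in> edges G"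
    and deg: "\<And>x. x \<in> verts G \<Longrightarrow> 2 \<le> degree G x"
    and n: "6 \<le> card (verts G)" and m: "card (verts G) < card (edges G)"
  shows "card (verts G) + 8 + of_bool (card (verts G) = 6)
    \<le> card (meeting (delete_edge G {v, a}) {v, a})"
proof -
  let ?K = "delete_edge G {v, a}" and ?comp = "\<lambda>v a. card (component (delete_vertex G v) a)"
  have K: "simple_graph ?K" by (rule simple_graph_delete_edge[OF G(2)])
  have end_ge: "card (verts G) + 4 + ?comp x y \<le> card (meeting ?K {v, a})"
    if xy: "{x, y} = {v, a}" for x y
  proof -
    have "{x, y} \<in> edges G" using va xy by simp
    then have ends: "x \<noteq> y" "x \<in> verts G" "y \<in> verts G"
      using simple_graph_edge_ends[OF G(2)] by auto
    have "card (verts ?K) + 1 \<le> Suc (card (edges ?K))"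
      using m card_edges_delete_edge[OF G(2) va] by simp
    then have "card (verts G) + 4 \<le> card (rooted ?K x)"
      using card_rooted_ge[OF G(1) K, of x 1] ends(2) by simp
    moreover have "delete_vertex ?K x = delete_vertex G x"
      using xy by (intro delete_vertex_delete_edge) blast
    then have "?comp x y \<le> card (rooted (delete_vertex ?K x) y)"
      using card_component_le_card_rooted[OF simple_graph_delete_vertex[OF G(2)], of y x] ends
      by simp
    ultimately show ?thesis using card_meeting_insert[OF K, of x "{y}"] xy by simp
  qed
  note both = end_ge[OF refl] end_ge[OF insert_commute]
  have cover: "card (verts G) < ?comp v a + ?comp a v"
    by (rule components_of_edge_ends_cover[OF G va])
  show ?thesis
  proof (cases "card (verts G) = 6")
    case True
    have "?comp v a = 5 \<or> ?comp v a \<le> 3" "?comp a v = 5 \<or> ?comp a v \<le> 3"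
      using order_of_component_delete_vertex[OF G(2) va deg]
        order_of_component_delete_vertex[OF G(2) _ deg, of a v] va True
      by (auto simp: insert_commute)
    then show ?thesis using cover both True by auto
  next
    case False
    then have "4 \<le> ?comp v a \<or> 4 \<le> ?comp a v" using cover n by linarith
    then show ?thesis using both False by auto
  qed
qed

lemma (in bridge) card_meeting_ends_bridge:
  assumes "connected_graph A" "card (verts A) \<le> card (edges A)"
    and "connected_graph B" "card (verts B) \<le> card (edges B)"
  shows "card (verts joined) + 8 \<le> card (meeting (delete_edge joined {v, a}) {v, a})"
proof -
  have "card (verts A) + 4 \<le> card (rooted A v)" "card (verts B) + 4 \<le> card (rooted B a)"
    using card_rooted_ge[of A v 1] card_rooted_ge[of B a 1] assms simple_sides ends by simp_all
  then show ?thesis using card_meeting_ends_ge order_joined by linarith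
qed

lemma (in bridge) core_index_order_6_bridge:
  assumes n: "card (verts joined) = 6"
    and A: "connected_graph A" "card (verts A) \<le> card (edges A)"
    and B: "connected_graph B" "card (verts B) \<le> card (edges B)"
  shows "69 \<le> core_index joined"
proof -
  have "3 \<le> card (verts A)" "3 \<le> card (verts B)"
    using order_ge_3_if_order_le_size simple_sides ends A(2) B(2) by blast+
  then have three: "card (verts A) = 3" "card (verts B) = 3" using order_joined n by linarith+
  have "core_index X = 10 \<and> 7 \<le> card (rooted X x)"
    if X: "connected_graph X" "simple_graph X" "card (verts X) = 3" "3 \<le> card (edges X)"
      "x \<in> verts X"
    for X and x :: 'a
    using core_index_triangle[OF X(2,3)] card_edges_le_choose[OF X(2)]
      card_rooted_ge[OF X(1,2,5), of 1] X(3,4)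
    by (simp add: choose_two)
  then have sides: "core_index A = 10 \<and> 7 \<le> card (rooted A v)"
    "core_index B = 10 \<and> 7 \<le> card (rooted B a)"
    using A B three simple_sides ends by auto
  then have "7 * 7 \<le> card (rooted A v) * card (rooted B a)" by (intro mult_le_mono) simp_all
  then show ?thesis using core_index_joined sides by simp
qed

lemma (in contraction) bicyclic_bound_le_if_contract:
  assumes con: "connected_graph G"
    and n: "6 \<le> card (verts G)" and m: "card (verts G) < card (edges G)"
    and deg: "\<And>x. x \<in> verts G \<Longrightarrow> 2 \<le> degree G x"
    and contracted: "bicyclic_bound (card (verts (contract G v a))) \<le> core_index (contract G v a)"
  shows "bicyclic_bound (card (verts G)) \<le> core_index G"
proof -
  let ?K = "delete_edge G {v, a}" and ?n = "card (verts G)"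
  have gain: ?thesis if "?n + 8 + of_bool (?n = 6) \<le> card (meeting ?K {v, a})"
    unfolding core_index_contract
    by (rule bicyclic_bound_le_add[OF card_contract(1) n contracted that])
  show ?thesis
  proof (cases "connected_graph ?K")
    case True
    show ?thesis by (rule gain[OF card_meeting_ends_non_bridge[OF True simple edge deg n m]])
  next
    case False
    then obtain A B where bridge: "bridge A B v a" and join: "G = bridge_join v a A B"
      and sides: "connected_graph A" "card (verts A) \<le> card (edges A)"
        "connected_graph B" "card (verts B) \<le> card (edges B)"
      using bridge_decomposition_min_degree_2[OF con simple edge deg] by metis
    interpret bridge A B v a by (rule bridge)
    show ?thesis
    proof (cases "?n = 6")
      case True
      then show ?thesis
        using core_index_order_6_bridge sides unfolding join by (simp add: bicyclic_bound_def)
    next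
      case False
      then show ?thesis using gain card_meeting_ends_bridge[OF sides] unfolding join by simp
    qed
  qed
qed

lemma bicyclic_bound_le_if_delete_pendant:
  assumes G: "connected_graph G" "simple_graph G" and v: "v \<in> verts G" "degree G v = 1"
    and n: "6 \<le> card (verts G)" and m: "card (verts G) < card (edges G)"
    and deleted: "bicyclic_bound (card (verts (delete_vertex G v)))
      \<le> core_index (delete_vertex G v)"
  shows "bicyclic_bound (card (verts G)) \<le> core_index G"
proof -
  have "card (verts G) + 8 + of_bool (card (verts G) = 6) \<le> card (rooted G v)"
    using card_rooted_ge[OF G v(1), of 2] m by simp
  with card_verts_delete_vertex[OF G(2) v(1)] n deleted show ?thesis
    unfolding core_index_delete_vertex[OF G(2), of v] by (rule bicyclic_bound_le_add)
qed

lemma connected_delete_triangle_edge: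
  assumes G: "connected_graph G" "simple_graph G" and tri: "in_triangle G v a"
  shows "connected_graph (delete_edge G {v, a})"
proof (rule connected_delete_edge[OF G(1)])
  obtain c where third: "{v, c} \<in> edges G" "{a, c} \<in> edges G"
    using tri by (auto simp: in_triangle_def)
  have "c \<noteq> v" "c \<noteq> a" using third simple_graph_edge_ends(1)[OF G(2)] by auto
  then have "(v, c) \<in> adj (delete_edge G {v, a})" "(c, a) \<in> adj (delete_edge G {v, a})"
    using third by (auto simp: in_adj_iff doubleton_eq_iff insert_commute)
  then show "(v, a) \<in> (adj (delete_edge G {v, a}))\<^sup>*" by (meson r_into_rtrancl rtrancl_into_rtrancl)
qed

lemma bicyclic_cases [consumes 3]:
  assumes G: "connected_graph G" "simple_graph G" and n: "5 \<le> card (verts G)"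
  obtains (order_5) "card (verts G) = 5"
  | (pendant) v where "6 \<le> card (verts G)" "v \<in> verts G" "degree G v = 1"
  | (sparse_edge) v a where "6 \<le> card (verts G)" "\<And>x. x \<in> verts G \<Longrightarrow> 2 \<le> degree G x"
      "{v, a} \<in> edges G" "\<not> in_triangle G v a"
  | (triangles) "6 \<le> card (verts G)" "\<And>u w. {u, w} \<in> edges G \<Longrightarrow> in_triangle G u w"
proof -
  consider "card (verts G) = 5" | "6 \<le> card (verts G)" "\<exists>v\<in>verts G. degree G v = 1"
    | (no_pendant) "6 \<le> card (verts G)" "\<forall>v\<in>verts G. degree G v \<noteq> 1"
    using n by fastforce
  then show thesis
  proof cases
    case no_pendant
    have deg: "2 \<le> degree G x" if "x \<in> verts G" for x
      using degree_pos[OF G that] bspec[OF no_pendant(2) that] n by simp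
    show thesis
    proof (cases "\<exists>v a. {v, a} \<in> edges G \<and> \<not> in_triangle G v a")
      case True
      then show thesis using sparse_edge[OF no_pendant(1) deg] by blast
    next
      case False
      then show thesis using triangles[OF no_pendant(1)] by blast
    qed
  qed (use order_5 pendant in blast)+
qed

theorem core_index_bicyclic:
  assumes "connected_graph G" "simple_graph G"
    and "5 \<le> card (verts G)" "card (verts G) < card (edges G)"
  shows "bicyclic_bound (card (verts G)) \<le> core_index G"
  using assms
proof (induction "card (verts G) + card (edges G)" arbitrary: G rule: less_induct)
  case less
  note G = less.prems(1,2) and m = less.prems(4)
  from less.prems(1-3) show ?case
  proof (cases rule: bicyclic_cases)
    case order_5
    then show ?thesis using core_index_order_5_ge[OF G] m by (simp add: bicyclic_bound_def)
  next
    case (pendant v)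
    let ?H = "delete_vertex G v"
    have "bicyclic_bound (card (verts ?H)) \<le> core_index ?H"
      using card_verts_delete_vertex[OF G(2) pendant(2)] card_edges_delete_vertex[OF G(2), of v]
        pendant m connected_delete_degree_one[OF G pendant(3)] simple_graph_delete_vertex[OF G(2)]
      by (intro less.hyps) simp_all
    then show ?thesis by (rule bicyclic_bound_le_if_delete_pendant[OF G pendant(2,3,1) m])
  next
    case (sparse_edge v a)
    interpret contraction G v a using G(2) sparse_edge(3,4) by unfold_locales
    have "bicyclic_bound (card (verts (contract G v a))) \<le> core_index (contract G v a)"
      using card_contract sparse_edge(1) m ends simple_contract connected_contract[OF G(1)]
      by (intro less.hyps) simp_all
    then show ?thesis using G(1) sparse_edge(1,2) m by (intro bicyclic_bound_le_if_contract)
  next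
    case triangles
    have "edges G \<noteq> {}" using m by auto
    then obtain v a where va: "{v, a} \<in> edges G" using simple_graph_edgeE[OF G(2)] by blast
    let ?H = "delete_edge G {v, a}"
    have "bicyclic_bound (card (verts ?H)) \<le> core_index ?H"
      using card_edges_delete_edge[OF G(2) va] size_ge_if_edges_in_triangles[OF G triangles(2)]
        triangles(1) simple_graph_delete_edge[OF G(2)]
        connected_delete_triangle_edge[OF G triangles(2)[OF va]]
      by (intro less.hyps) simp_all
    then show ?thesis
      using core_index_mono[OF G(2) subgraph_delete_edge[OF G(2)], of "{v, a}"] by simp
  qed
qed

section \<open>Two triangles joined by a path\<close>

definition triangle :: "'a \<Rightarrow> 'a \<Rightarrow> 'a \<Rightarrow> 'a ugraph" where
  "triangle x y z = ({x, y, z}, {{x, y}, {x, z}, {y, z}})"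

lemma simple_triangle: "distinct [x, y, z] \<Longrightarrow> simple_graph (triangle x y z)"
  by (auto simp: triangle_def simple_graph_def)

lemma core_index_triangle_graph:
  assumes "distinct [x, y, z]"
  shows "core_index (triangle x y z) = 10"
  using assms core_index_triangle[OF simple_triangle[OF assms]]
  by (auto simp: triangle_def doubleton_eq_iff)

lemma card_rooted_triangle:
  assumes "distinct [x, y, z]"
  shows "card (rooted (triangle x y z) x) = 7"
proof -
  interpret bridge "({y}, {})" "({z}, {})" y z
    using assms by unfold_locales (simp_all add: simple_graph_singleton)
  have "delete_vertex (triangle x y z) x = joined"
    using assms by (auto simp: triangle_def delete_vertex_def induced_def bridge_join_def)
  then have "core_index (delete_vertex (triangle x y z) x) = 3"
    using core_index_joined by (simp add: core_index_singleton card_rooted_singleton)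
  then show ?thesis
    using core_index_delete_vertex[OF simple_triangle[OF assms], of x]
      core_index_triangle_graph[OF assms]
    by simp
qed

primrec lollipop :: "nat \<Rightarrow> nat \<Rightarrow> nat \<Rightarrow> nat ugraph" where
  "lollipop p q 0 = triangle 0 p q"
| "lollipop p q (Suc k) = bridge_join (Suc k) k ({Suc k}, {}) (lollipop p q k)"

lemma verts_lollipop: "verts (lollipop p q k) = {..k} \<union> {p, q}"
  by (induction k) (simp_all add: triangle_def atMost_Suc insert_commute)

lemma edges_lollipop:
  "edges (lollipop p q k) = {{i, Suc i} |i. i < k} \<union> {{0, p}, {0, q}, {p, q}}"
proof (induction k)
  case (Suc k)
  have "{{i, Suc i} |i. i < Suc k} = insert {Suc k, k} {{i, Suc i} |i. i < k}"
    by (auto simp: less_Suc_eq insert_commute)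
  then show ?case using Suc by auto
qed (auto simp: triangle_def)

lemma lollipop_counts:
  assumes "k < p" "p < q"
  shows "simple_graph (lollipop p q k)"
    and "card (rooted (lollipop p q k) k) = k + 7"
    and "2 * core_index (lollipop p q k) = k\<^sup>2 + 15 * k + 20"
proof -
  have "simple_graph (lollipop p q k) \<and> card (rooted (lollipop p q k) k) = k + 7
    \<and> 2 * core_index (lollipop p q k) = k\<^sup>2 + 15 * k + 20"
    using assms(1)
  proof (induction k)
    case 0
    then show ?case
      using assms(2) simple_triangle[of 0 p q] card_rooted_triangle[of 0 p q]
        core_index_triangle_graph[of 0 p q] by simp
  next
    case (Suc k)
    then interpret bridge "({Suc k}, {})" "lollipop p q k" "Suc k" k
      using assms(2) by unfold_locales (auto simp: simple_graph_singleton verts_lollipop)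
    show ?case
      using Suc simple_joined card_rooted_joined core_index_joined
      by (simp add: core_index_singleton card_rooted_singleton power2_eq_square)
  qed
  then show "simple_graph (lollipop p q k)" "card (rooted (lollipop p q k) k) = k + 7"
    "2 * core_index (lollipop p q k) = k\<^sup>2 + 15 * k + 20" by simp_all
qed

lemma two_triangle_graph_eq_bridge_join:
  "two_triangle_graph (k + 6)
    = bridge_join k (Suc k) (lollipop (k + 2) (k + 3) k) (triangle (Suc k) (k + 4) (k + 5))"
proof -
  have "{{i, i + 1} |i. i + 1 < k + 2} = insert {k, Suc k} {{i, Suc i} |i. i < k}"
    by (auto simp: less_Suc_eq)
  then have "edges (two_triangle_graph (k + 6))
    = insert {k, Suc k}
        (edges (lollipop (k + 2) (k + 3) k) \<union> edges (triangle (Suc k) (k + 4) (k + 5)))"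
    by (auto simp: two_triangle_graph_def edges_lollipop triangle_def eval_nat_numeral)
  moreover have "verts (two_triangle_graph (k + 6))
    = verts (lollipop (k + 2) (k + 3) k) \<union> verts (triangle (Suc k) (k + 4) (k + 5))"
    by (auto simp: two_triangle_graph_def verts_lollipop triangle_def)
  ultimately show ?thesis by (simp add: prod_eq_iff)
qed

theorem core_index_two_triangle_graph:
  assumes "6 \<le> n"
  shows "2 * core_index (two_triangle_graph n) = n\<^sup>2 + 17 * n"
proof -
  obtain k where n: "n = k + 6" using assms by (metis add.commute le_Suc_ex)
  have distinct: "distinct [Suc k, k + 4, k + 5]" by simp
  interpret bridge "lollipop (k + 2) (k + 3) k" "triangle (Suc k) (k + 4) (k + 5)" k "Suc k"
    using lollipop_counts(1)[of k "k + 2" "k + 3"] simple_triangle[OF distinct]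
    by unfold_locales (auto simp: verts_lollipop triangle_def)
  have "2 * core_index (two_triangle_graph n) = k\<^sup>2 + 15 * k + 20 + 20 + 14 * (k + 7)"
    unfolding n two_triangle_graph_eq_bridge_join core_index_joined
      card_rooted_triangle[OF distinct] core_index_triangle_graph[OF distinct]
    using lollipop_counts(2,3)[of k "k + 2" "k + 3"] by simp
  also have "\<dots> = n\<^sup>2 + 17 * n" unfolding n by (simp add: power2_eq_square algebra_simps)
  finally show ?thesis .
qed

section \<open>The minimum core index\<close>

lemma degree_ge_2_if_no_pendant:
  assumes "connected_graph G" "simple_graph G" "2 \<le> card (verts G)" "\<forall>v. \<not> pendant_vertex G v"
    and "x \<in> verts G"
  shows "2 \<le> degree G x"
  using degree_pos[OF assms(1,2,5,3)] assms(4,5) by (force simp: pendant_vertex_def)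

lemma core_index_min_degree_2:
  assumes G: "connected_graph G" "simple_graph G" and n: "5 \<le> card (verts G)"
    and deg: "\<And>x. x \<in> verts G \<Longrightarrow> 2 \<le> degree G x"
  shows "core_index G = (card (verts G))\<^sup>2 + 1 \<or> bicyclic_bound (card (verts G)) \<le> core_index G"
proof (cases "card (edges G) \<le> card (verts G)")
  case True
  then show ?thesis using core_index_unicyclic_min_degree_2[OF G _ _ deg] n by simp
next
  case False
  then show ?thesis using core_index_bicyclic[OF G n] by simp
qed

lemma bicyclic_bound_ge_cycle:
  assumes "5 \<le> n" "n \<le> 16"
  shows "n\<^sup>2 + 1 \<le> bicyclic_bound n"
proof (cases "n = 5")
  case False
  have "n\<^sup>2 \<le> 16 * n" unfolding power2_eq_square using assms(2) by simp
  then have "2 * (n\<^sup>2 + 1) \<le> n\<^sup>2 + 17 * n" using assms(1) by simp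
  then show ?thesis using False by (simp add: bicyclic_bound_def)
qed (simp add: bicyclic_bound_def)

lemma bicyclic_bound_gt_16:
  assumes "16 < n"
  shows "2 * bicyclic_bound n = n\<^sup>2 + 17 * n" "bicyclic_bound n \<le> n\<^sup>2 + 1"
proof -
  have "even (n\<^sup>2 + 17 * n)" by simp
  then show twice: "2 * bicyclic_bound n = n\<^sup>2 + 17 * n"
    using assms by (simp add: bicyclic_bound_def)
  have "17 * n \<le> n\<^sup>2" unfolding power2_eq_square using assms by simp
  then show "bicyclic_bound n \<le> n\<^sup>2 + 1" using twice by linarith
qed

theorem theorem5p16:
  fixes G :: "'a ugraph" and n :: nat
  assumes "n \<ge> 5"
    and "simple_graph G"
    and "connected_graph G"
    and "card (fst G) = n"
    and "\<forall>v. \<not> pendant_vertex G v"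
  shows "(n \<le> 16 \<longrightarrow> core_index G \<ge> core_index (cycle_graph n))
    \<and> (n > 16 \<longrightarrow> core_index G \<ge> core_index (two_triangle_graph n))
    \<and> real (core_index G) \<ge> min ((real n)\<^sup>2 + 1) (((real n)\<^sup>2 + 17 * real n) / 2)"
proof -
  have "core_index G = n\<^sup>2 + 1 \<or> bicyclic_bound n \<le> core_index G"
    using core_index_min_degree_2[OF assms(3,2)] degree_ge_2_if_no_pendant[OF assms(3,2) _ assms(5)]
      assms(1,4) by simp
  then consider (small) "n \<le> 16" "n\<^sup>2 + 1 \<le> core_index G"
    | (large) "16 < n" "bicyclic_bound n \<le> core_index G"
    using bicyclic_bound_ge_cycle[OF assms(1)] bicyclic_bound_gt_16(2)[of n] by fastforce
  then show ?thesis
  proof cases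
    case small
    then have "real (n\<^sup>2 + 1) \<le> real (core_index G)" by (intro of_nat_mono)
    then show ?thesis using small core_index_cycle_graph[of n] assms(1) by simp
  next
    case large
    then have twice: "n\<^sup>2 + 17 * n \<le> 2 * core_index G"
      using bicyclic_bound_gt_16(1)[of n] by linarith
    then have "real (n\<^sup>2 + 17 * n) \<le> real (2 * core_index G)" by (intro of_nat_mono)
    moreover have "core_index (two_triangle_graph n) \<le> core_index G"
      using twice large(1) core_index_two_triangle_graph[of n] by linarith
    ultimately show ?thesis using large(1) by (simp add: min_le_iff_disj)
  qed
qed

end
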